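(* Let $f:\mathbb{R}^d\to\mathbb{R}$, $g:\mathbb{R}^d\to\mathbb{R}^n$, $h:\mathbb{R}^d\to\mathbb{R}^m$ and let $\Phi:\mathbb{R}^d\to(-\infty,\infty]$ be lower semi-continuous. Let $x^*$, with $\Phi(x^* )$ finite, be a local minimizer of the problem $$\min\ f(x)+\Phi(x)\quad\text{s.t.}\quad g(x)\le 0,\ h(x)=0,$$ and suppose $f,g,h$ are Lipschitz around $x^*$. Assume that either $\partial^\infty$-quasi-normality holds at $x^*$, or $\partial^\infty$-RCPLD holds at $x^*$ and $g,h$ are smooth around $x^*$. Then $x^*$ is a KKT point, i.e., there exist $\lambda\in\mathbb{R}^n$ and $\mu\in\mathbb{R}^m$ such that $$0\in\partial f(x^* )+\partial\Phi(x^* )+\sum_{i=1}^n\lambda_i\,\partial g_i(x^* )+\sum_{j=1}^m\partial(\mu_jh_j)(x^* ),\qquad \lambda_i\ge 0,\ \lambda_ig_i(x^* )=0,\ i=1,\dots,n.$$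
   Context: Subdifferentials. For $\varphi:\mathbb{R}^d\to[-\infty,\infty]$ finite at $\bar x$: the regular subdifferential is $\hat\partial\varphi(\bar x)=\{v:\varphi(x)\ge\varphi(\bar x)+v^T(x-\bar x)+o(\|x-\bar x\|)\ \forall x\}$; the limiting subdifferential is $\partial\varphi(\bar x)=\{v:\exists x^k\to\bar x,\ \varphi(x^k)\to\varphi(\bar x),\ v^k\in\hat\partial\varphi(x^k),\ v^k\to v\}$; the horizon subdifferential is $\partial^\infty\varphi(\bar x)=\{v:\exists x^k\to\bar x,\ \varphi(x^k)\to\varphi(\bar x),\ v^k\in\hat\partial\varphi(x^k),\ t_k\ge 0,\ t_k\to0,\ t_kv^k\to v\}$. Feasible set: $\mathcal F=\{x:g(x)\le0,\ h(x)=0\}$; for $x\in\mathcal F$, $\mathcal I_g(x)=\{i:g_i(x)=0\}$. "Smooth" means continuously differentiable. $\mathcal B_\delta(x)$ is the closed ball of radius $\delta$ centered at $x$. $\partial^\infty$-quasi-normality at $x\in\mathcal F$: there is no nonzero $(\lambda,\mu)\in\mathbb{R}^n\times\mathbb{R}^m$ for which there exists a sequence $x^k\to x$ such that (1) $0\in\partial^\infty\Phi(x)+\sum_{i=1}^n\lambda_i\partial g_i(x)+\sum_{j=1}^m\partial(\mu_jh_j)(x)$; (2) $\lambda_i\ge0$ and $\lambda_ig_i(x)=0$ for $i=1,\dots,n$; (3) for all $k$: $g_i(x^k)>0$ for every $i$ with $\lambda_i>0$, and $\mu_jh_j(x^k)>0$ for every $j$ with $\mu_j\ne0$. $\partial^\infty$-RCPLD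 at $x\in\mathcal F$ (with $g,h$ smooth around $x$): let $\mathcal J\subseteq\{1,\dots,m\}$ be such that $\{\nabla h_j(x):j\in\mathcal J\}$ is a basis for $\mathrm{span}\{\nabla h_j(x):j=1,\dots,m\}$. The condition holds at $x$ if there exists $\delta>0$ such that (i) $\{\nabla h_j(y):j=1,\dots,m\}$ has the same rank for each $y\in\mathcal B_\delta(x)$; (ii) for each $\mathcal I\subseteq\mathcal I_g(x)$, if there exist $\{\lambda_i\ge0:i\in\mathcal I\}$ and $\{\mu_j:j\in\mathcal J\}$ not all zero such that $0\in\partial^\infty\Phi(x)+\sum_{i\in\mathcal I}\lambda_i\nabla g_i(x)+\sum_{j\in\mathcal J}\mu_j\nabla h_j(x)$, then $\{\nabla g_i(y),\nabla h_j(y):i\in\mathcal I,j\in\mathcal J\}$ is linearly dependent for each $y\in\mathcal B_\delta(x)$. *)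

theory Defs
  imports "HOL-Analysis.Analysis" "HOL-Library.Landau_Symbols"
begin

text \<open>
  The remainder is real-valued and the inequality is required at every point. For functions
  that never take the value \<open>- \<infinity>\<close> this says the same as
  \<open>liminf (\<phi> x - \<phi> xb - v \<bullet> (x - xb)) / norm (x - xb) \<ge> 0\<close> as \<open>x \<rightarrow> xb\<close>, \<open>x \<noteq> xb\<close>.
  All three subdifferentials are empty at points where the function is not finite.
\<close>

definition regular_subdiff :: "(real^'d \<Rightarrow> ereal) \<Rightarrow> real^'d \<Rightarrow> (real^'d) set" where
  "regular_subdiff \<phi> xb =
     {v. \<bar>\<phi> xb\<bar> \<noteq> \<infinity> \<and>
         (\<exists>r. r \<in> o[at xb](\<lambda>x. norm (x - xb)) \<and>
              (\<forall>x. \<phi> x \<ge> \<phi> xb + ereal (v \<bullet> (x - xb) + r x)))}"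

definition limiting_subdiff :: "(real^'d \<Rightarrow> ereal) \<Rightarrow> real^'d \<Rightarrow> (real^'d) set" where
  "limiting_subdiff \<phi> xb =
     {v. \<bar>\<phi> xb\<bar> \<noteq> \<infinity> \<and>
         (\<exists>X V. X \<longlonglongrightarrow> xb \<and> (\<lambda>k. \<phi> (X k)) \<longlonglongrightarrow> \<phi> xb \<and>
                (\<forall>k. V k \<in> regular_subdiff \<phi> (X k)) \<and> V \<longlonglongrightarrow> v)}"

definition horizon_subdiff :: "(real^'d \<Rightarrow> ereal) \<Rightarrow> real^'d \<Rightarrow> (real^'d) set" where
  "horizon_subdiff \<phi> xb =
     {v. \<bar>\<phi> xb\<bar> \<noteq> \<infinity> \<and>
         (\<exists>X V t. X \<longlonglongrightarrow> xb \<and> (\<lambda>k. \<phi> (X k)) \<longlonglongrightarrow> \<phi> xb \<and>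
                  (\<forall>k. V k \<in> regular_subdiff \<phi> (X k)) \<and>
                  (\<forall>k. t k \<ge> 0) \<and> t \<longlonglongrightarrow> 0 \<and> (\<lambda>k. t k *\<^sub>R V k) \<longlonglongrightarrow> v)}"

definition lower_semicontinuous :: "(real^'d \<Rightarrow> ereal) \<Rightarrow> bool" where
  "lower_semicontinuous \<phi> \<longleftrightarrow> (\<forall>x. \<phi> x \<le> Liminf (at x) \<phi>)"

definition lipschitz_around ::
  "('a::metric_space \<Rightarrow> 'b::metric_space) \<Rightarrow> 'a \<Rightarrow> bool" where
  "lipschitz_around f x \<longleftrightarrow> (\<exists>\<delta>>0. \<exists>L. L-lipschitz_on (cball x \<delta>) f)"

definition smooth_around ::
  "('a::real_normed_vector \<Rightarrow> 'b::real_normed_vector) \<Rightarrow> 'a \<Rightarrow> bool" where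
  "smooth_around f x \<longleftrightarrow>
     (\<exists>\<delta>>0. \<exists>f' :: 'a \<Rightarrow> 'a \<Rightarrow>\<^sub>L 'b.
        (\<forall>y\<in>ball x \<delta>. (f has_derivative blinfun_apply (f' y)) (at y)) \<and>
        continuous_on (ball x \<delta>) f')"

definition gradient :: "('a::real_inner \<Rightarrow> real) \<Rightarrow> 'a \<Rightarrow> 'a" where
  "gradient f x = (THE D. GDERIV f x :> D)"

abbreviation grad_comp :: "(real^'d \<Rightarrow> real^'n) \<Rightarrow> 'n \<Rightarrow> real^'d \<Rightarrow> real^'d" where
  "grad_comp g i y \<equiv> gradient (\<lambda>z. g z $ i) y"

text \<open>
  Linear dependence of an indexed family: repeated vectors count as dependent, which the
  set-based library notion applied to the range of the family would not detect.
\<close>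

definition lin_dep_family :: "'i set \<Rightarrow> ('i \<Rightarrow> 'a::real_vector) \<Rightarrow> bool" where
  "lin_dep_family S F \<longleftrightarrow> (\<exists>c. (\<exists>s\<in>S. c s \<noteq> 0) \<and> (\<Sum>s\<in>S. c s *\<^sub>R F s) = 0)"

definition feasible_set ::
  "(real^'d \<Rightarrow> real^'n) \<Rightarrow> (real^'d \<Rightarrow> real^'m) \<Rightarrow> (real^'d) set" where
  "feasible_set g h = {x. (\<forall>i. g x $ i \<le> 0) \<and> h x = 0}"

definition active_set :: "(real^'d \<Rightarrow> real^'n) \<Rightarrow> real^'d \<Rightarrow> 'n set" where
  "active_set g x = {i. g x $ i = 0}"

definition local_minimizer :: "('a::metric_space \<Rightarrow> ereal) \<Rightarrow> 'a set \<Rightarrow> 'a \<Rightarrow> bool" where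
  "local_minimizer \<phi> S x \<longleftrightarrow>
     x \<in> S \<and> (\<exists>\<delta>>0. \<forall>y\<in>S \<inter> ball x \<delta>. \<phi> x \<le> \<phi> y)"

text \<open>Sums of sets, here and below, are Minkowski sums.\<close>

definition horizon_quasi_normality ::
  "(real^'d \<Rightarrow> ereal) \<Rightarrow> (real^'d \<Rightarrow> real^'n) \<Rightarrow> (real^'d \<Rightarrow> real^'m) \<Rightarrow> real^'d \<Rightarrow> bool" where
  "horizon_quasi_normality \<Phi> g h x \<longleftrightarrow>
     (\<nexists>(lam :: real^'n) (mu :: real^'m).
        (lam, mu) \<noteq> 0 \<and>
        (\<exists>X. X \<longlonglongrightarrow> x \<and>
           0 \<in> horizon_subdiff \<Phi> x
               + (\<Sum>i\<in>UNIV. (\<lambda>v. lam $ i *\<^sub>R v) ` limiting_subdiff (\<lambda>y. ereal (g y $ i)) x)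
               + (\<Sum>j\<in>UNIV. limiting_subdiff (\<lambda>y. ereal (mu $ j * h y $ j)) x) \<and>
           (\<forall>i. lam $ i \<ge> 0 \<and> lam $ i * g x $ i = 0) \<and>
           (\<forall>k. (\<forall>i. lam $ i > 0 \<longrightarrow> g (X k) $ i > 0) \<and>
                (\<forall>j. mu $ j \<noteq> 0 \<longrightarrow> mu $ j * h (X k) $ j > 0))))"

text \<open>
  \<open>J\<close> is an arbitrary index set whose gradients form a basis (as a family) of the span of all
  equality gradients at \<open>x\<close>; the condition holds if it holds for some such \<open>J\<close>.
\<close>

definition horizon_rcpld ::
  "(real^'d \<Rightarrow> ereal) \<Rightarrow> (real^'d \<Rightarrow> real^'n) \<Rightarrow> (real^'d \<Rightarrow> real^'m) \<Rightarrow> real^'d \<Rightarrow> bool" where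
  "horizon_rcpld \<Phi> g h x \<longleftrightarrow>
     (\<exists>J :: 'm set.
        \<not> lin_dep_family J (\<lambda>j. grad_comp h j x) \<and>
        span ((\<lambda>j. grad_comp h j x) ` J) = span (range (\<lambda>j. grad_comp h j x)) \<and>
        (\<exists>\<delta>>0.
           (\<forall>y\<in>cball x \<delta>. dim (range (\<lambda>j. grad_comp h j y)) = dim (range (\<lambda>j. grad_comp h j x))) \<and>
           (\<forall>I. I \<subseteq> active_set g x \<longrightarrow>
              (\<exists>(lam :: 'n \<Rightarrow> real) (mu :: 'm \<Rightarrow> real).
                 (\<forall>i\<in>I. lam i \<ge> 0) \<and>
                 ((\<exists>i\<in>I. lam i \<noteq> 0) \<or> (\<exists>j\<in>J. mu j \<noteq> 0)) \<and>
                 0 \<in> horizon_subdiff \<Phi> x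
                     + {(\<Sum>i\<in>I. lam i *\<^sub>R grad_comp g i x) + (\<Sum>j\<in>J. mu j *\<^sub>R grad_comp h j x)}) \<longrightarrow>
              (\<forall>y\<in>cball x \<delta>.
                 lin_dep_family (I <+> J) (case_sum (\<lambda>i. grad_comp g i y) (\<lambda>j. grad_comp h j y))))))"

definition kkt_point ::
  "(real^'d \<Rightarrow> real) \<Rightarrow> (real^'d \<Rightarrow> ereal) \<Rightarrow> (real^'d \<Rightarrow> real^'n) \<Rightarrow> (real^'d \<Rightarrow> real^'m)
     \<Rightarrow> real^'d \<Rightarrow> bool" where
  "kkt_point f \<Phi> g h x \<longleftrightarrow>
     (\<exists>(lam :: real^'n) (mu :: real^'m).
        0 \<in> limiting_subdiff (\<lambda>y. ereal (f y)) x
            + limiting_subdiff \<Phi> x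
            + (\<Sum>i\<in>UNIV. (\<lambda>v. lam $ i *\<^sub>R v) ` limiting_subdiff (\<lambda>y. ereal (g y $ i)) x)
            + (\<Sum>j\<in>UNIV. limiting_subdiff (\<lambda>y. ereal (mu $ j * h y $ j)) x) \<and>
        (\<forall>i. lam $ i \<ge> 0 \<and> lam $ i * g x $ i = 0))"

end

theory Submission
  imports Defs
begin

text \<open>
  The problem is penalised: for growing weights \<open>k\<close> one minimises \<open>f + \<Phi>\<close> plus \<open>k\<close> times half the
  squared constraint violations plus half the squared distance to the local minimiser, and reads off
  multiplier estimates \<open>k\<close> times violation. Every summand but \<open>\<Phi>\<close> gets its own copy of the variable,
  coupled to \<open>x\<close> by a quadratic term. The first-order conditions then hold blockwise for regular
  subdifferentials, so no sum rule is needed; and since the coupling weight may be chosen after \<open>k\<close>,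
  the copies agree to any prescribed precision.

  If the multiplier estimates stay bounded along a subsequence, their limit gives the KKT conditions.
  Otherwise, dividing by their norm yields a nonzero multiplier in an inclusion with the horizon
  subdifferential of \<open>\<Phi>\<close>. Under quasi-normality this is excluded because the violated constraints
  stay violated along the penalty minimisers. Under RCPLD one first passes to multipliers
  supported on a linearly independent family of gradients at the penalty minimisers (constant rank and
  conic Caratheodory), and a nonzero limit would make that family dependent.
\<close>

section \<open>Regular and limiting subgradients\<close>

text \<open>Multipliers are read off at separate copies of the variable, while both qualification
  conditions speak of one point: quasi-normality asks for all violations along a single sequence,
  RCPLD for all gradients at a single y. So everything has to be moved from the copies to
  \<open>X k\<close>, and the error of this move is multiplied by the weight k. This is why the
  precision \<epsilon> is a parameter of the construction: for quasi-normality it is 1/(k+1)^2, for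
  RCPLD it comes from uniform continuity of the gradients, which are made to agree up to 1/(k+1)^2.
  Violations enter squared because half the square of a residual is differentiable even when the
  residual is one-sided. Its linearisation replaces the penalty by a scalar multiple of the
  constraint, and that scalar is the multiplier. The squared distance forces the penalty minimisers
  to converge to the local minimiser although it need not be strict. Under RCPLD the multipliers are
  reduced before the passage to the limit; the bounded/unbounded alternative is applied to the
  reduced ones.\<close>

lemma regular_subdiff_iff:
  assumes "\<And>x. \<Phi> x \<noteq> -\<infinity>"
  shows "v \<in> regular_subdiff \<Phi> x \<longleftrightarrow> \<bar>\<Phi> x\<bar> \<noteq> \<infinity> \<and>
    (\<forall>e>0. \<forall>\<^sub>F y in nhds x. \<Phi> x + ereal (v \<bullet> (y - x) - e * norm (y - x)) \<le> \<Phi> y)"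
    (is "?L \<longleftrightarrow> ?F \<and> ?R")
proof
  assume L: ?L
  then obtain r where fin: ?F and r: "r \<in> o[at x](\<lambda>y. norm (y - x))"
    and le: "\<And>y. \<Phi> y \<ge> \<Phi> x + ereal (v \<bullet> (y - x) + r y)"
    unfolding regular_subdiff_def by auto
  have "\<forall>\<^sub>F y in nhds x. \<Phi> x + ereal (v \<bullet> (y - x) - e * norm (y - x)) \<le> \<Phi> y" if "e > 0" for e
  proof -
    have "\<forall>\<^sub>F y in at x. norm (r y) \<le> e * norm (norm (y - x))"
      using landau_o.smallD[OF r that] .
    then have "\<forall>\<^sub>F y in at x. \<Phi> x + ereal (v \<bullet> (y - x) - e * norm (y - x)) \<le> \<Phi> y"
    proof eventually_elim
      case (elim y)
      have "\<Phi> x + ereal (v \<bullet> (y - x) - e * norm (y - x)) \<le> \<Phi> x + ereal (v \<bullet> (y - x) + r y)"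
        using elim by (intro add_left_mono) auto
      with le[of y] show ?case by order
    qed
    then show ?thesis
      using fin by (auto simp: eventually_nhds_conv_at zero_ereal_def[symmetric])
  qed
  with fin show "?F \<and> ?R" by blast
next
  assume R: "?F \<and> ?R"
  \<comment> \<open>The largest nonpositive remainder that the global inequality permits; where
    \<Phi> is infinite the inequality holds trivially and 0 will do. The local estimate is exactly
    what makes this remainder small.\<close>
  define r where "r y = (if \<Phi> y = \<infinity> then 0
    else min 0 (real_of_ereal (\<Phi> y) - real_of_ereal (\<Phi> x) - v \<bullet> (y - x)))" for y
  obtain p where p: "\<Phi> x = ereal p" using R by auto
  have "r \<in> o[at x](\<lambda>y. norm (y - x))"
  proof (rule landau_o.smallI)
    fix e :: real assume "e > 0"
    with R have "\<forall>\<^sub>F y in nhds x. \<Phi> x + ereal (v \<bullet> (y - x) - e * norm (y - x)) \<le> \<Phi> y" by blast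
    then have "\<forall>\<^sub>F y in nhds x. norm (r y) \<le> e * norm (norm (y - x))"
    proof eventually_elim
      case (elim y)
      show ?case
      proof (cases "\<Phi> y")
        case (real a)
        with elim p \<open>e > 0\<close> show ?thesis by (auto simp: r_def min_def)
      qed (use assms[of y] \<open>e > 0\<close> in \<open>simp_all add: r_def\<close>)
    qed
    then show "\<forall>\<^sub>F y in at x. norm (r y) \<le> e * norm (norm (y - x))"
      by (simp add: eventually_nhds_conv_at)
  qed
  moreover have "\<Phi> y \<ge> \<Phi> x + ereal (v \<bullet> (y - x) + r y)" for y
    using assms[of y] p by (cases "\<Phi> y") (auto simp: r_def min_def)
  ultimately show ?L using R unfolding regular_subdiff_def by (intro CollectI conjI exI[of _ r] allI) simp_all
qed

lemma regular_subdiff_real_iff: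
  "v \<in> regular_subdiff (\<lambda>y. ereal (q y)) x \<longleftrightarrow>
    (\<forall>e>0. \<forall>\<^sub>F y in nhds x. q x + v \<bullet> (y - x) - e * norm (y - x) \<le> q y)"
  by (subst regular_subdiff_iff) (auto simp: algebra_simps)

lemma has_derivative_eventually_nhds:
  assumes "(p has_derivative D) (at x)" and "e > 0"
  shows "\<forall>\<^sub>F y in nhds x. norm (p y - p x - D (y - x)) \<le> e * norm (y - x)"
proof -
  obtain d where "d > 0" "\<forall>y. norm (y - x) < d \<longrightarrow> norm (p y - p x - D (y - x)) \<le> e * norm (y - x)"
    using assms unfolding has_derivative_at_alt by blast
  then show ?thesis unfolding eventually_nhds_metric dist_norm by blast
qed

text \<open>Fermat's rule with a perturbation differentiable at x: the error of its linearisation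
  goes into the remainder. All first-order conditions below, for the penalty problems and elsewhere,
  come from this rule.\<close>

lemma regular_subdiff_local_min:
  assumes "\<And>x. \<Phi> x \<noteq> -\<infinity>" and "\<bar>\<Phi> x\<bar> \<noteq> \<infinity>"
    and min: "\<forall>\<^sub>F y in nhds x. \<Phi> x + ereal (p x) \<le> \<Phi> y + ereal (p y)"
    and der: "(p has_derivative (\<lambda>z. z \<bullet> d)) (at x)"
  shows "- d \<in> regular_subdiff \<Phi> x"
proof (subst regular_subdiff_iff; (intro conjI allI impI)?)
  fix e :: real assume "e > 0"
  with der have "\<forall>\<^sub>F y in nhds x. norm (p y - p x - (y - x) \<bullet> d) \<le> e * norm (y - x)"
    by (rule has_derivative_eventually_nhds)
  with min show "\<forall>\<^sub>F y in nhds x. \<Phi> x + ereal (- d \<bullet> (y - x) - e * norm (y - x)) \<le> \<Phi> y"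
  proof eventually_elim
    case (elim y)
    obtain a where a: "\<Phi> x = ereal a" using assms(2) by auto
    show ?case
    proof (cases "\<Phi> y")
      case (real b)
      with elim a have "a + p x \<le> b + p y" "p y - p x - (y - x) \<bullet> d \<le> e * norm (y - x)" by auto
      with real a show ?thesis by (simp add: inner_commute)
    qed (use assms(1)[of y] in auto)
  qed
qed (use assms in auto)

text \<open>Test the subgradient inequality in the direction v itself: t |v|^2 - e t |v| is at most
  the increment of q, hence at most L t |v|. Divide by t |v|.\<close>

lemma regular_subdiff_norm_le:
  assumes "v \<in> regular_subdiff (\<lambda>y. ereal (q y)) x"
    and "L-lipschitz_on S q" and "x \<in> interior S"
  shows "norm v \<le> L"
proof (rule field_le_epsilon)
  fix e :: real assume "e > 0"
  with assms(1) have "\<forall>\<^sub>F y in nhds x. q x + v \<bullet> (y - x) - e * norm (y - x) \<le> q y"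
    unfolding regular_subdiff_real_iff by blast
  moreover have "\<forall>\<^sub>F y in nhds x. y \<in> interior S"
    using assms(3) by (intro eventually_nhds_in_open) auto
  moreover have "filterlim (\<lambda>t. x + t *\<^sub>R v) (nhds x) (at_right 0)"
  proof -
    have "((\<lambda>t. x + t *\<^sub>R v) \<longlongrightarrow> x + 0 *\<^sub>R v) (at_right 0)" by (intro tendsto_intros)
    then show ?thesis by simp
  qed
  ultimately have "\<forall>\<^sub>F t in at_right 0. q x + v \<bullet> (x + t *\<^sub>R v - x) - e * norm (x + t *\<^sub>R v - x) \<le> q (x + t *\<^sub>R v)"
      "\<forall>\<^sub>F t in at_right 0. x + t *\<^sub>R v \<in> interior S"
    by (auto dest: eventually_compose_filterlim)
  moreover have "\<forall>\<^sub>F t in at_right 0. (t::real) > 0" by (simp add: eventually_at_right_less)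
  ultimately have "\<forall>\<^sub>F t in at_right (0::real). norm v \<le> L + e"
  proof eventually_elim
    case (elim t)
    have "x + t *\<^sub>R v \<in> S" "x \<in> S" using elim assms(3) interior_subset[of S] by blast+
    then have "q (x + t *\<^sub>R v) - q x \<le> L * norm (t *\<^sub>R v)"
      using lipschitz_onD[OF assms(2), of "x + t *\<^sub>R v" x] by (simp add: dist_norm)
    with elim have "t * (norm v * norm v) \<le> t * ((L + e) * norm v)"
      by (simp add: algebra_simps dot_square_norm power2_eq_square)
    then have "norm v * norm v \<le> (L + e) * norm v" using elim by simp
    then show ?case using lipschitz_on_nonneg[OF assms(2)] \<open>e > 0\<close>
      by (cases "v = 0") auto
  qed
  then show "norm v \<le> L + e" by simp
qed

lemma regular_subdiff_scale:
  assumes "v \<in> regular_subdiff (\<lambda>y. ereal (q y)) x" and "a > 0"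
  shows "a *\<^sub>R v \<in> regular_subdiff (\<lambda>y. ereal (a * q y)) x"
  unfolding regular_subdiff_real_iff
proof (intro allI impI)
  fix e :: real assume "e > 0"
  then have "e / a > 0" using assms by simp
  with assms(1) have "\<forall>\<^sub>F y in nhds x. q x + v \<bullet> (y - x) - e / a * norm (y - x) \<le> q y"
    unfolding regular_subdiff_real_iff by blast
  then show "\<forall>\<^sub>F y in nhds x. a * q x + a *\<^sub>R v \<bullet> (y - x) - e * norm (y - x) \<le> a * q y"
  proof eventually_elim
    case (elim y)
    from mult_left_mono[OF this, of a] assms(2) show ?case by (simp add: algebra_simps)
  qed
qed

text \<open>The scalar function is only required to be differentiable at the one point, so the
  composition with a Lipschitz \<open>q\<close> may be replaced by its linearisation.\<close>

lemma regular_subdiff_chain: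
  assumes v: "v \<in> regular_subdiff (\<lambda>y. ereal (\<phi> (q y))) x"
    and lip: "L-lipschitz_on S q" "x \<in> interior S"
    and der: "(\<phi> has_real_derivative a) (at (q x))"
  shows "v \<in> regular_subdiff (\<lambda>y. ereal (a * q y)) x"
  unfolding regular_subdiff_real_iff
proof (intro allI impI)
  fix e :: real assume "e > 0"
  \<comment> \<open>The linearisation error e' |q y - q x| is at most e' L |y - x|, which has to fit
    into e/2 |y - x|. The summand 1 keeps the denominator positive when L = 0.\<close>
  define e' where "e' = e / (2 * (L + 1))"
  have L: "L \<ge> 0" using lip lipschitz_on_nonneg by blast
  with \<open>e > 0\<close> have e': "e' > 0" "e' * L \<le> e / 2"
    by (auto simp: e'_def field_simps)
  have "\<forall>\<^sub>F y in nhds x. \<phi> (q x) + v \<bullet> (y - x) - e / 2 * norm (y - x) \<le> \<phi> (q y)"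
    using v \<open>e > 0\<close> unfolding regular_subdiff_real_iff by (meson half_gt_zero)
  moreover have S: "\<forall>\<^sub>F y in nhds x. y \<in> interior S"
    using lip by (intro eventually_nhds_in_open) auto
  moreover have "\<forall>\<^sub>F y in nhds x. norm (\<phi> (q y) - \<phi> (q x) - a * (q y - q x)) \<le> e' * norm (q y - q x)"
  proof -
    have "\<forall>\<^sub>F t in nhds (q x). norm (\<phi> t - \<phi> (q x) - a * (t - q x)) \<le> e' * norm (t - q x)"
      using der e'(1) unfolding has_field_derivative_def by (rule has_derivative_eventually_nhds)
    moreover have "continuous_on (interior S) q"
      using lip(1) interior_subset lipschitz_on_continuous_on continuous_on_subset by metis
    then have "(q \<longlongrightarrow> q x) (nhds x)"
      using lip(2) by (simp add: continuous_on_eq_continuous_at isCont_def tendsto_at_iff_tendsto_nhds)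
    ultimately show ?thesis by (rule eventually_compose_filterlim)
  qed
  ultimately show "\<forall>\<^sub>F y in nhds x. a * q x + v \<bullet> (y - x) - e * norm (y - x) \<le> a * q y"
  proof eventually_elim
    case (elim y)
    have "y \<in> S" "x \<in> S" using elim lip(2) interior_subset[of S] by blast+
    then have "norm (q y - q x) \<le> L * norm (y - x)"
      using lipschitz_onD[OF lip(1), of y x] by (simp add: dist_norm)
    then have "e' * norm (q y - q x) \<le> e' * (L * norm (y - x))" using e' by simp
    also have "\<dots> \<le> e / 2 * norm (y - x)" using mult_right_mono[OF e'(2), of "norm (y - x)"] by (simp add: mult.assoc)
    finally show ?case using elim by (simp add: algebra_simps abs_le_iff)
  qed
qed

lemma regular_subdiff_gradient:
  assumes "(q has_derivative (\<lambda>z. z \<bullet> d)) (at x)"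
  shows "v \<in> regular_subdiff (\<lambda>y. ereal (a * q y)) x \<longleftrightarrow> v = a *\<^sub>R d"
proof -
  have der: "((\<lambda>y. a * q y) has_derivative (\<lambda>z. z \<bullet> (a *\<^sub>R d))) (at x)"
    using assms by (auto intro!: derivative_eq_intros)
  have der': "((\<lambda>y. - (a * q y)) has_derivative (\<lambda>z. z \<bullet> - (a *\<^sub>R d))) (at x)"
    using assms by (auto intro!: derivative_eq_intros)
  \<comment> \<open>Fermat's rule with the perturbation -a q: the sum is constant, so every point
    minimises it.\<close>
  have "- (- (a *\<^sub>R d)) \<in> regular_subdiff (\<lambda>y. ereal (a * q y)) x"
    by (rule regular_subdiff_local_min[OF _ _ _ der']) auto
  moreover have "v = a *\<^sub>R d" if v: "v \<in> regular_subdiff (\<lambda>y. ereal (a * q y)) x"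
  proof -
    have "norm (v - a *\<^sub>R d) \<le> 0"
    proof (rule field_le_epsilon)
      fix e :: real assume "e > 0"
      have "\<forall>\<^sub>F y in nhds x. a * q x + v \<bullet> (y - x) - e/2 * norm (y - x) \<le> a * q y"
        using v \<open>e > 0\<close> unfolding regular_subdiff_real_iff by (meson half_gt_zero)
      moreover have "\<forall>\<^sub>F y in nhds x. norm (a * q y - a * q x - (y - x) \<bullet> (a *\<^sub>R d)) \<le> e / 2 * norm (y - x)"
        using der half_gt_zero[OF \<open>e > 0\<close>] by (rule has_derivative_eventually_nhds)
      ultimately have "\<forall>\<^sub>F y in nhds x. (v - a *\<^sub>R d) \<bullet> (y - x) \<le> e * norm (y - x)"
      proof eventually_elim
        case (elim y)
        then show ?case
          unfolding real_norm_def inner_commute[of "y - x"] inner_diff_left[of v] by linarith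
      qed
      then obtain r where r: "r > 0" "\<And>y. dist y x < r \<Longrightarrow> (v - a *\<^sub>R d) \<bullet> (y - x) \<le> e * norm (y - x)"
        unfolding eventually_nhds_metric by blast
      define u where "u = v - a *\<^sub>R d"
      show "norm (v - a *\<^sub>R d) \<le> 0 + e"
      proof (cases "u = 0")
        case False
        \<comment> \<open>The inequality is tested in the direction u at distance r/2, inside the
          radius where it holds; it then reads |u|^2 <= e |u|.\<close>
        define t where "t = r / (2 * norm u)"
        have t: "t > 0" using r False by (simp add: t_def)
        have "dist (x + t *\<^sub>R u) x < r" using r False by (simp add: t_def dist_norm)
        from r(2)[OF this] have "t * (norm u * norm u) \<le> t * (e * norm u)" using t
          by (simp add: u_def[symmetric] dot_square_norm power2_eq_square algebra_simps)
        then show ?thesis using t False by (simp add: u_def)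
      qed (use \<open>e > 0\<close> in \<open>simp add: u_def\<close>)
    qed
    then show ?thesis by simp
  qed
  ultimately show ?thesis by auto
qed

section \<open>Lower semicontinuity and existence of minimisers\<close>

lemma lower_semicontinuous_sublevel:
  assumes "lower_semicontinuous \<Phi>" and "a < \<Phi> x"
  shows "\<forall>\<^sub>F y in nhds x. a < \<Phi> y"
proof -
  have "\<Phi> x \<le> Liminf (at x) \<Phi>" using assms unfolding lower_semicontinuous_def by blast
  with assms(2) have "\<forall>\<^sub>F y in at x. a < \<Phi> y" using le_Liminf_iff by blast
  with assms(2) show ?thesis by (simp add: eventually_nhds_conv_at)
qed

text \<open>Phrased with upper bounds \<open>a k\<close> in place of a limit of \<Phi> along
  \<open>X\<close>, since comparison of minimal values yields only such bounds.\<close>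

lemma lower_semicontinuous_sequentially:
  assumes "lower_semicontinuous \<Phi>" and "X \<longlonglongrightarrow> x"
    and "\<And>k. \<Phi> (X k) \<le> a k" and "a \<longlonglongrightarrow> A"
  shows "\<Phi> x \<le> A"
proof (rule dense_le)
  fix b assume "b < \<Phi> x"
  from lower_semicontinuous_sublevel[OF assms(1) this] assms(2)
  have "\<forall>\<^sub>F k in sequentially. b < \<Phi> (X k)" by (auto simp: filterlim_iff)
  then have "\<forall>\<^sub>F k in sequentially. b \<le> a k"
    by eventually_elim (meson assms(3) less_imp_le order_trans)
  with assms(4) show "b \<le> A" by (intro tendsto_lowerbound) auto
qed

text \<open>A minimising sequence has a convergent subsequence; subtracting the real continuous term
  leaves bounds on \<Phi> alone and never produces a difference of infinities. The projection \<pi>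
  is there because only one block of the decoupled variable enters \<Phi>.\<close>

lemma lower_semicontinuous_attains_min:
  fixes \<pi> :: "'a::metric_space \<Rightarrow> real^'d"
  assumes "lower_semicontinuous \<Phi>" and "compact K" "K \<noteq> {}"
    and "continuous_on K \<pi>" and "continuous_on K G"
  shows "\<exists>z\<in>K. \<forall>z'\<in>K. \<Phi> (\<pi> z) + ereal (G z) \<le> \<Phi> (\<pi> z') + ereal (G z')"
proof -
  define F where "F z = \<Phi> (\<pi> z) + ereal (G z)" for z
  obtain u where u: "\<And>n. u n \<in> F ` K" "u \<longlonglongrightarrow> Inf (F ` K)"
    using Inf_as_limit[of "F ` K"] assms(3) by blast
  from u(1) have "\<forall>n. \<exists>z. z \<in> K \<and> u n = F z" by blast
  then obtain Z where Z: "\<And>n. Z n \<in> K" "\<And>n. u n = F (Z n)" by metis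
  obtain z r where z: "z \<in> K" "strict_mono r" "(Z \<circ> r) \<longlonglongrightarrow> z"
    using assms(2) Z(1) unfolding compact_def by metis
  have "(\<lambda>n. \<pi> (Z (r n))) \<longlonglongrightarrow> \<pi> z" "(\<lambda>n. G (Z (r n))) \<longlonglongrightarrow> G z"
    using continuous_on_tendsto_compose[OF assms(4) z(3,1)] continuous_on_tendsto_compose[OF assms(5) z(3,1)] Z(1)
    by (auto simp: o_def)
  moreover have "(\<lambda>n. u (r n)) \<longlonglongrightarrow> Inf (F ` K)"
    using LIMSEQ_subseq_LIMSEQ[OF u(2) z(2)] by (simp add: o_def)
  ultimately have "(\<lambda>n. u (r n) - ereal (G (Z (r n)))) \<longlonglongrightarrow> Inf (F ` K) - ereal (G z)"
    unfolding minus_ereal_def by (intro tendsto_add_ereal_general1 tendsto_uminus_ereal) auto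
  moreover have "\<Phi> (\<pi> (Z (r n))) \<le> u (r n) - ereal (G (Z (r n)))" for n
    unfolding Z(2) F_def by (cases "\<Phi> (\<pi> (Z (r n)))") auto
  ultimately have "\<Phi> (\<pi> z) \<le> Inf (F ` K) - ereal (G z)"
    by (intro lower_semicontinuous_sequentially[OF assms(1) \<open>(\<lambda>n. \<pi> (Z (r n))) \<longlonglongrightarrow> \<pi> z\<close>])
  then have "F z \<le> Inf (F ` K)" unfolding F_def
    by (simp add: ereal_le_minus)
  then show ?thesis using z(1) unfolding F_def le_Inf_iff by blast
qed

section \<open>Limiting subgradients of locally Lipschitz functions\<close>

lemma limiting_subdiffI:
  assumes "\<bar>\<Phi> x\<bar> \<noteq> \<infinity>" and "X \<longlonglongrightarrow> x" and "(\<lambda>k. \<Phi> (X k)) \<longlonglongrightarrow> \<Phi> x"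
    and "\<forall>\<^sub>F k in sequentially. V k \<in> regular_subdiff \<Phi> (X k)" and "V \<longlonglongrightarrow> v"
  shows "v \<in> limiting_subdiff \<Phi> x"
proof -
  obtain N where N: "\<And>k. V (k + N) \<in> regular_subdiff \<Phi> (X (k + N))"
    using assms(4) unfolding eventually_sequentially by (metis le_add2)
  show ?thesis
    unfolding limiting_subdiff_def
    using assms(1) LIMSEQ_ignore_initial_segment[OF assms(2), of N]
      LIMSEQ_ignore_initial_segment[OF assms(3), of N] N LIMSEQ_ignore_initial_segment[OF assms(5), of N]
    by (intro CollectI conjI exI[of _ "\<lambda>k. X (k + N)"] exI[of _ "\<lambda>k. V (k + N)"]) auto
qed

lemma horizon_subdiffI:
  assumes "\<bar>\<Phi> x\<bar> \<noteq> \<infinity>" and "X \<longlonglongrightarrow> x" and "(\<lambda>k. \<Phi> (X k)) \<longlonglongrightarrow> \<Phi> x"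
    and "\<forall>k. V k \<in> regular_subdiff \<Phi> (X k)" "\<forall>k. t k \<ge> 0" "t \<longlonglongrightarrow> 0"
    and "(\<lambda>k. t k *\<^sub>R V k) \<longlonglongrightarrow> v"
  shows "v \<in> horizon_subdiff \<Phi> x"
  using assms unfolding horizon_subdiff_def by blast

lemma lipschitz_tendsto:
  fixes q :: "'a::euclidean_space \<Rightarrow> real"
  assumes "L-lipschitz_on (cball x \<delta>) q" "\<delta> > 0" and "U \<longlonglongrightarrow> x"
  shows "(\<lambda>k. q (U k)) \<longlonglongrightarrow> q x"
proof -
  have "continuous_on (cball x \<delta>) q" using assms(1) by (rule lipschitz_on_continuous_on)
  then have "isCont q x" using assms(2) by (intro continuous_on_interior) auto
  then show ?thesis using assms(3) isCont_tendsto_compose by blast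
qed

lemma lipschitz_cmult:
  fixes q :: "'a::metric_space \<Rightarrow> real"
  assumes "L-lipschitz_on S q"
  shows "(\<bar>m\<bar> * L)-lipschitz_on S (\<lambda>y. m * q y)"
proof (rule lipschitz_onI)
  fix y z assume "y \<in> S" "z \<in> S"
  then have "\<bar>q y - q z\<bar> \<le> L * dist y z" using lipschitz_onD[OF assms] by (simp add: dist_real_def)
  then have "\<bar>m\<bar> * \<bar>q y - q z\<bar> \<le> \<bar>m\<bar> * (L * dist y z)" by (intro mult_left_mono) auto
  then show "dist (m * q y) (m * q z) \<le> \<bar>m\<bar> * L * dist y z"
    by (simp add: dist_real_def right_diff_distrib[symmetric] abs_mult mult.assoc)
qed (use lipschitz_on_nonneg[OF assms] in simp)

text \<open>Minimise q plus n |y - x|^2 over the ball. Comparison with x gives n |Y - x| <= L, so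
  the minimisers tend to x and their regular subgradients -2n (Y - x) are bounded by 2L; any cluster
  point will do. This is what makes zero multipliers harmless: 0 times an empty subdifferential
  would be empty and would destroy the whole Minkowski sum.\<close>

lemma limiting_subdiff_nonempty:
  fixes q :: "real^'d \<Rightarrow> real"
  assumes lip: "L-lipschitz_on (cball x \<delta>) q" and "\<delta> > 0"
  shows "limiting_subdiff (\<lambda>y. ereal (q y)) x \<noteq> {}"
proof -
  have "\<exists>y\<in>cball x \<delta>. \<forall>z\<in>cball x \<delta>. q y + real (Suc n) * ((y - x) \<bullet> (y - x)) \<le> q z + real (Suc n) * ((z - x) \<bullet> (z - x))" for n
    using lipschitz_on_continuous_on[OF lip] \<open>\<delta> > 0\<close>
    by (intro continuous_attains_inf continuous_intros) auto
  then obtain Y where Y: "\<And>n. Y n \<in> cball x \<delta>"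
    "\<And>n z. z \<in> cball x \<delta> \<Longrightarrow> q (Y n) + real (Suc n) * ((Y n - x) \<bullet> (Y n - x)) \<le> q z + real (Suc n) * ((z - x) \<bullet> (z - x))"
    by metis
  have L: "L \<ge> 0" using lip lipschitz_on_nonneg by blast
  have bd: "real (Suc n) * norm (Y n - x) \<le> L" for n
  proof -
    have "q x - q (Y n) \<le> L * norm (Y n - x)"
      using lipschitz_onD[OF lip, of x "Y n"] Y(1)[of n] \<open>\<delta> > 0\<close>
      by (simp add: dist_real_def dist_norm norm_minus_commute)
    with Y(2)[of x n] \<open>\<delta> > 0\<close>
    have "real (Suc n) * ((Y n - x) \<bullet> (Y n - x)) \<le> L * norm (Y n - x)" by simp
    then have "(real (Suc n) * norm (Y n - x)) * norm (Y n - x) \<le> L * norm (Y n - x)"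
      by (simp only: dot_square_norm power2_eq_square mult.assoc)
    then show ?thesis using L by (cases "Y n = x") auto
  qed
  have "norm (Y n - x) \<le> L * inverse (real (Suc n))" for n
    using bd[of n] by (simp add: field_simps)
  moreover have "(\<lambda>n. L * inverse (real (Suc n))) \<longlonglongrightarrow> L * 0"
    by (intro tendsto_intros LIMSEQ_inverse_real_of_nat)
  ultimately have "(\<lambda>n. Y n - x) \<longlonglongrightarrow> 0"
    by (intro Lim_null_comparison[of "\<lambda>n. Y n - x" "\<lambda>n. L * inverse (real (Suc n))"]) auto
  then have "Y \<longlonglongrightarrow> x" by (simp add: LIM_zero_iff)
  have reg: "\<forall>\<^sub>F n in sequentially. - (2 * real (Suc n)) *\<^sub>R (Y n - x) \<in> regular_subdiff (\<lambda>y. ereal (q y)) (Y n)"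
  proof -
    have "\<forall>\<^sub>F n in sequentially. Y n \<in> ball x \<delta>"
      using \<open>Y \<longlonglongrightarrow> x\<close> \<open>\<delta> > 0\<close> by (intro topological_tendstoD) auto
    then show ?thesis
    proof eventually_elim
      case (elim n)
      have "\<forall>\<^sub>F z in nhds (Y n). z \<in> ball x \<delta>" using elim by (intro eventually_nhds_in_open) auto
      then have min: "\<forall>\<^sub>F z in nhds (Y n). ereal (q (Y n)) + ereal (real (Suc n) * ((Y n - x) \<bullet> (Y n - x)))
          \<le> ereal (q z) + ereal (real (Suc n) * ((z - x) \<bullet> (z - x)))"
        by eventually_elim (use Y(2) in simp)
      have "- ((2 * real (Suc n)) *\<^sub>R (Y n - x)) \<in> regular_subdiff (\<lambda>y. ereal (q y)) (Y n)"
        by (rule regular_subdiff_local_min[OF _ _ min])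
          (auto intro!: derivative_eq_intros simp: inner_commute algebra_simps fun_eq_iff)
      then show ?case by (simp only: scaleR_minus_left)
    qed
  qed
  define V where "V n = - (2 * real (Suc n)) *\<^sub>R (Y n - x)" for n
  have "V n \<in> cball 0 (2 * L)" for n
  proof -
    have "norm (V n) = 2 * (real (Suc n) * norm (Y n - x))" unfolding V_def by simp
    also have "\<dots> \<le> 2 * L" using bd[of n] by linarith
    finally show ?thesis by (simp only: mem_cball_0)
  qed
  then obtain v r where r: "strict_mono r" "(V \<circ> r) \<longlonglongrightarrow> v"
    using compact_cball[of "0::real^'d" "2*L"] unfolding compact_def by metis
  have "(Y \<circ> r) \<longlonglongrightarrow> x" using \<open>Y \<longlonglongrightarrow> x\<close> r(1) by (rule LIMSEQ_subseq_LIMSEQ)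
  then have "v \<in> limiting_subdiff (\<lambda>y. ereal (q y)) x"
    using lipschitz_tendsto[OF lip \<open>\<delta> > 0\<close>, of "Y \<circ> r"] r eventually_subseq[OF r(1) reg[folded V_def]]
    by (intro limiting_subdiffI[where X="Y \<circ> r" and V = "V \<circ> r"]) (auto simp: o_def)
  then show ?thesis by blast
qed

text \<open>Closedness under moving multipliers. If m0 is nonzero, the factor m0 / m k is eventually
  positive and tends to 1; positivity matters because regular subgradients may only be scaled by
  positive numbers. If m0 = 0, the Lipschitz bound forces the subgradients to 0.\<close>

lemma limiting_subdiff_scaled_limit:
  fixes q :: "real^'d \<Rightarrow> real"
  assumes lip: "L-lipschitz_on (cball x \<delta>) q" "\<delta> > 0" and U: "U \<longlonglongrightarrow> x" and m: "m \<longlonglongrightarrow> m0"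
    and V: "\<forall>\<^sub>F k in sequentially. V k \<in> regular_subdiff (\<lambda>y. ereal (m k * q y)) (U k)"
    and v: "V \<longlonglongrightarrow> v"
  shows "v \<in> limiting_subdiff (\<lambda>y. ereal (m0 * q y)) x"
proof (cases "m0 = 0")
  case True
  have "\<forall>\<^sub>F k in sequentially. U k \<in> ball x \<delta>"
    using U \<open>\<delta> > 0\<close> by (intro topological_tendstoD) auto
  with V have "\<forall>\<^sub>F k in sequentially. norm (V k) \<le> \<bar>m k\<bar> * L"
    by eventually_elim (rule regular_subdiff_norm_le[OF _ lipschitz_cmult[OF lip(1)]], auto)
  moreover have "(\<lambda>k. \<bar>m k\<bar> * L) \<longlonglongrightarrow> 0"
    using m True by (intro tendsto_eq_intros) auto
  ultimately have "V \<longlonglongrightarrow> 0" by (rule Lim_null_comparison)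
  with v have "v = 0" by (rule LIMSEQ_unique)
  \<comment> \<open>The function is now the zero function, so constant sequences at x witness its
    limiting subgradient 0.\<close>
  have "0 \<in> regular_subdiff (\<lambda>y. ereal (m0 * q y)) x"
    unfolding regular_subdiff_real_iff using True by simp
  then show ?thesis
    by (intro limiting_subdiffI[where X="\<lambda>_. x" and V="\<lambda>_. 0"]) (auto simp: \<open>v = 0\<close>)
next
  case False
  have "(\<lambda>k. m0 / m k) \<longlonglongrightarrow> m0 / m0" using m False by (intro tendsto_intros)
  then have lim: "(\<lambda>k. m0 / m k) \<longlonglongrightarrow> 1" using False by simp
  then have "\<forall>\<^sub>F k in sequentially. m0 / m k > 0" by (rule order_tendstoD) simp
  with V have "\<forall>\<^sub>F k in sequentially. (m0 / m k) *\<^sub>R V k \<in> regular_subdiff (\<lambda>y. ereal (m0 * q y)) (U k)"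
  proof eventually_elim
    case (elim k)
    from regular_subdiff_scale[OF elim] have "(m0 / m k) *\<^sub>R V k \<in> regular_subdiff (\<lambda>y. ereal (m0 / m k * (m k * q y))) (U k)" .
    moreover have "m k \<noteq> 0" using elim by auto
    ultimately show ?case by simp
  qed
  moreover have "(\<lambda>k. (m0 / m k) *\<^sub>R V k) \<longlonglongrightarrow> v" using tendsto_scaleR[OF lim v] by simp
  moreover have "(\<lambda>k. ereal (m0 * q (U k))) \<longlonglongrightarrow> ereal (m0 * q x)"
    using lipschitz_tendsto[OF lip U] by (intro tendsto_intros) 
  ultimately show ?thesis using U by (intro limiting_subdiffI[where X=U]) auto
qed

text \<open>The KKT conditions multiply the subdifferential of an inequality constraint, whereas the
  limits above lie in the subdifferential of the multiple. For m > 0 the witness is v / m; for m = 0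
  one has v = 0 and any limiting subgradient of q is a witness.\<close>

lemma limiting_subdiff_scaled_subset:
  fixes q :: "real^'d \<Rightarrow> real"
  assumes lip: "L-lipschitz_on (cball x \<delta>) q" "\<delta> > 0" and "m \<ge> 0"
    and v: "v \<in> limiting_subdiff (\<lambda>y. ereal (m * q y)) x"
  shows "v \<in> (\<lambda>w. m *\<^sub>R w) ` limiting_subdiff (\<lambda>y. ereal (q y)) x"
proof -
  obtain X V where XV: "X \<longlonglongrightarrow> x" "\<And>k. V k \<in> regular_subdiff (\<lambda>y. ereal (m * q y)) (X k)" "V \<longlonglongrightarrow> v"
    using v unfolding limiting_subdiff_def by blast
  show ?thesis
  proof (cases "m = 0")
    case True
    have "norm (V k) \<le> 0" for k
      by (rule regular_subdiff_norm_le[OF XV(2), of _ UNIV]) (auto simp: True intro: lipschitz_intros)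
    then have "V = (\<lambda>_. 0)" by auto
    with XV(3) have "v = 0" by (simp add: LIMSEQ_const_iff)
    then show ?thesis using limiting_subdiff_nonempty[OF lip] True by auto
  next
    case False
    with \<open>m \<ge> 0\<close> have "m > 0" by simp
    have "inverse m *\<^sub>R V k \<in> regular_subdiff (\<lambda>y. ereal (q y)) (X k)" for k
      using regular_subdiff_scale[OF XV(2), of "inverse m" k] \<open>m > 0\<close>
      by (simp add: mult.assoc[symmetric])
    moreover have "(\<lambda>k. inverse m *\<^sub>R V k) \<longlonglongrightarrow> inverse m *\<^sub>R v" using XV(3) by (intro tendsto_intros)
    moreover have "(\<lambda>k. ereal (q (X k))) \<longlonglongrightarrow> ereal (q x)"
      using lipschitz_tendsto[OF lip XV(1)] by (intro tendsto_intros)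
    ultimately have "inverse m *\<^sub>R v \<in> limiting_subdiff (\<lambda>y. ereal (q y)) x"
      using XV(1) by (intro limiting_subdiffI[where X=X]) auto
    then show ?thesis using \<open>m > 0\<close> by (intro image_eqI[of _ _ "inverse m *\<^sub>R v"]) auto
  qed
qed

section \<open>Bounded and unbounded multiplier sequences\<close>

lemma norm_vec_le_card:
  fixes v :: "'a::real_normed_vector^'s"
  assumes "\<And>s. norm (v $ s) \<le> C"
  shows "norm v \<le> real CARD('s) * C"
proof -
  have "norm v \<le> (\<Sum>s\<in>UNIV. norm (v $ s))" unfolding norm_vec_def by (intro L2_set_le_sum) auto
  also have "\<dots> \<le> real CARD('s) * C" using sum_bounded_above[of UNIV "\<lambda>s. norm (v $ s)" C] assms by simp
  finally show ?thesis .
qed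

text \<open>Normalising by \<open>1 + norm M\<close> treats both alternatives at once: the limit of the scaling
  factors is positive exactly when the multipliers stay bounded along the subsequence.\<close>

lemma multiplier_dichotomy:
  fixes f :: "real^'d \<Rightarrow> real" and q :: "'s::finite \<Rightarrow> real^'d \<Rightarrow> real"
    and M :: "nat \<Rightarrow> real^'s" and V :: "nat \<Rightarrow> real^'d^'s" and U :: "nat \<Rightarrow> 's \<Rightarrow> real^'d"
  assumes fin: "\<bar>\<Phi> x\<bar> \<noteq> \<infinity>" and "\<delta> > 0"
    and lipf: "Lf-lipschitz_on (cball x \<delta>) f" and lipq: "\<And>s. L-lipschitz_on (cball x \<delta>) (q s)"
    and X: "X \<longlonglongrightarrow> x" "(\<lambda>k. \<Phi> (X k)) \<longlonglongrightarrow> \<Phi> x" and Y: "Y \<longlonglongrightarrow> x" and U: "\<And>s. (\<lambda>k. U k s) \<longlonglongrightarrow> x"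
    and W: "\<forall>\<^sub>F k in sequentially. W k \<in> regular_subdiff \<Phi> (X k)"
    and VF: "\<forall>\<^sub>F k in sequentially. VF k \<in> regular_subdiff (\<lambda>y. ereal (f y)) (Y k)"
    and V: "\<forall>\<^sub>F k in sequentially. \<forall>s. V k $ s \<in> regular_subdiff (\<lambda>y. ereal (M k $ s * q s y)) (U k s)"
    and sum0: "(\<lambda>k. W k + VF k + (\<Sum>s\<in>UNIV. V k $ s)) \<longlonglongrightarrow> 0"
  obtains r t m v w where "strict_mono r" "\<And>k. t k \<ge> (0::real)" "\<And>k. t k \<le> 1" "(\<lambda>k. t k *\<^sub>R M (r k)) \<longlonglongrightarrow> m"
    "\<And>s. v s \<in> limiting_subdiff (\<lambda>y. ereal (m $ s * q s y)) x"
    "(\<exists>vf\<in>limiting_subdiff (\<lambda>y. ereal (f y)) x. w \<in> limiting_subdiff \<Phi> x \<and> vf + w + (\<Sum>s\<in>UNIV. v s) = 0) \<or>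
     (m \<noteq> 0 \<and> w \<in> horizon_subdiff \<Phi> x \<and> w + (\<Sum>s\<in>UNIV. v s) = 0)"
proof -
  have Yball: "\<forall>\<^sub>F k in sequentially. Y k \<in> ball x \<delta>"
    using Y \<open>\<delta> > 0\<close> by (intro topological_tendstoD) auto
  have Uball: "\<forall>\<^sub>F k in sequentially. \<forall>s. U k s \<in> ball x \<delta>"
    by (rule eventually_all_finite) (use U \<open>\<delta> > 0\<close> in \<open>intro topological_tendstoD, auto\<close>)
  have "\<forall>\<^sub>F k in sequentially. W k \<in> regular_subdiff \<Phi> (X k) \<and> norm (VF k) \<le> Lf
      \<and> VF k \<in> regular_subdiff (\<lambda>y. ereal (f y)) (Y k)
      \<and> (\<forall>s. V k $ s \<in> regular_subdiff (\<lambda>y. ereal (M k $ s * q s y)) (U k s))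
      \<and> (\<forall>s. norm (V k $ s) \<le> \<bar>M k $ s\<bar> * L)"
    using W VF V Yball Uball
  proof eventually_elim
    case (elim k)
    have "norm (VF k) \<le> Lf" using regular_subdiff_norm_le[OF elim(2) lipf] elim(4) by auto
    moreover have "norm (V k $ s) \<le> \<bar>M k $ s\<bar> * L" for s
    proof (rule regular_subdiff_norm_le[OF _ lipschitz_cmult[OF lipq]])
      show "V k $ s \<in> regular_subdiff (\<lambda>y. ereal (M k $ s * q s y)) (U k s)" using elim(3) by blast
    qed (use elim(5) in auto)
    ultimately show ?case using elim by auto
  qed
  then obtain N where N: "\<And>k. k \<ge> N \<Longrightarrow> W k \<in> regular_subdiff \<Phi> (X k)" "\<And>k. k \<ge> N \<Longrightarrow> norm (VF k) \<le> Lf"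
    "\<And>k. k \<ge> N \<Longrightarrow> VF k \<in> regular_subdiff (\<lambda>y. ereal (f y)) (Y k)"
    "\<And>k s. k \<ge> N \<Longrightarrow> V k $ s \<in> regular_subdiff (\<lambda>y. ereal (M k $ s * q s y)) (U k s)"
    "\<And>k s. k \<ge> N \<Longrightarrow> norm (V k $ s) \<le> \<bar>M k $ s\<bar> * L"
    unfolding eventually_sequentially by blast
  have L: "L \<ge> 0" using lipq lipschitz_on_nonneg by blast
  \<comment> \<open>The identity \<tau> |M| = 1 - \<tau> bounds the scaled multipliers by 1, and it
    gives them a limit of norm 1 as soon as \<tau> tends to 0.\<close>
  define \<tau> where "\<tau> k = inverse (1 + norm (M k))" for k
  have \<tau>: "\<tau> k > 0" "\<tau> k \<le> 1" "\<tau> k * norm (M k) = 1 - \<tau> k" for k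
  proof -
    have p: "1 + norm (M k) > 0" using norm_ge_zero[of "M k"] by linarith
    then show "\<tau> k > 0" by (simp add: \<tau>_def)
    show "\<tau> k \<le> 1" using p by (simp add: \<tau>_def inverse_le_1_iff)
    show "\<tau> k * norm (M k) = 1 - \<tau> k" using p by (simp add: \<tau>_def field_simps)
  qed
  define K where "K = cball (0::real) 1 \<times> cball (0::real^'s) 1 \<times> cball (0::real^'d^'s) (real CARD('s) * L)
    \<times> cball (0::real^'d) Lf"
  \<comment> \<open>\<open>VF\<close> is bounded by \<open>Lf\<close> and stays unscaled.
    \<open>W\<close> is left out because its scaled limit can be recovered from
    \<open>sum0\<close>.\<close>
  define Z where "Z k = (\<tau> (k+N), \<tau> (k+N) *\<^sub>R M (k+N), \<tau> (k+N) *\<^sub>R V (k+N), VF (k+N))" for k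
  have "Z k \<in> K" for k
  proof -
    have "norm ((\<tau> (k+N) *\<^sub>R V (k+N)) $ s) \<le> L" for s
    proof -
      have "norm ((\<tau> (k+N) *\<^sub>R V (k+N)) $ s) \<le> \<tau> (k+N) * (norm (M (k+N)) * L)"
        using \<tau>(1)[of "k+N"] N(5)[of "k+N" s] component_le_norm_cart[of "M (k+N)" s] L
        by (auto intro!: mult_left_mono order_trans[OF N(5)] mult_right_mono)
      also have "\<dots> = (1 - \<tau> (k+N)) * L" using \<tau>(3)[of "k+N"] by (simp add: mult.assoc[symmetric])
      also have "\<dots> \<le> 1 * L" using \<tau>(1)[of "k+N"] L by (intro mult_right_mono) auto
      finally show ?thesis by simp
    qed
    then have "norm (\<tau> (k+N) *\<^sub>R V (k+N)) \<le> real CARD('s) * L" by (rule norm_vec_le_card)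
    then show ?thesis
      using \<tau>[of "k+N"] N(2)[of "k+N"] by (simp add: K_def Z_def)
  qed
  moreover have "compact K" unfolding K_def by (intro compact_Times compact_cball)
  ultimately obtain z r where zr: "z \<in> K" "strict_mono r" "(Z \<circ> r) \<longlonglongrightarrow> z"
    unfolding compact_def by metis
  obtain t0 m0 v0 f0 where z: "z = (t0, m0, v0, f0)" by (metis prod_cases4)
  define \<rho> where "\<rho> k = r k + N" for k
  have \<rho>: "strict_mono \<rho>" "\<And>k. \<rho> k \<ge> N" using zr(2) by (auto simp: \<rho>_def strict_mono_def)
  have lim: "(\<lambda>k. (\<tau> (\<rho> k), \<tau> (\<rho> k) *\<^sub>R M (\<rho> k), \<tau> (\<rho> k) *\<^sub>R V (\<rho> k), VF (\<rho> k))) \<longlonglongrightarrow> (t0, m0, v0, f0)"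
    using zr(3) unfolding z Z_def o_def \<rho>_def .
  have lims: "(\<lambda>k. \<tau> (\<rho> k)) \<longlonglongrightarrow> t0" "(\<lambda>k. \<tau> (\<rho> k) *\<^sub>R M (\<rho> k)) \<longlonglongrightarrow> m0"
    "(\<lambda>k. \<tau> (\<rho> k) *\<^sub>R V (\<rho> k)) \<longlonglongrightarrow> v0" "(\<lambda>k. VF (\<rho> k)) \<longlonglongrightarrow> f0"
    using tendsto_fst[OF lim] tendsto_fst[OF tendsto_snd[OF lim]]
      tendsto_fst[OF tendsto_snd[OF tendsto_snd[OF lim]]] tendsto_snd[OF tendsto_snd[OF tendsto_snd[OF lim]]]
    by simp_all
  have sub: "(\<lambda>k. S (\<rho> k)) \<longlonglongrightarrow> l" if "S \<longlonglongrightarrow> l" for S and l :: "'z::topological_space"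
    using LIMSEQ_subseq_LIMSEQ[OF that \<rho>(1)] by (simp add: o_def)
  have comp: "(\<lambda>k. (\<tau> (\<rho> k) *\<^sub>R V (\<rho> k)) $ s) \<longlonglongrightarrow> v0 $ s" "(\<lambda>k. (\<tau> (\<rho> k) *\<^sub>R M (\<rho> k)) $ s) \<longlonglongrightarrow> m0 $ s" for s
    by (rule tendsto_vec_nth[OF lims(3)], rule tendsto_vec_nth[OF lims(2)])
  have limW: "(\<lambda>k. \<tau> (\<rho> k) *\<^sub>R W (\<rho> k)) \<longlonglongrightarrow> - t0 *\<^sub>R f0 - (\<Sum>s\<in>UNIV. v0 $ s)"
  proof -
    have "(\<lambda>k. \<tau> (\<rho> k) *\<^sub>R (W (\<rho> k) + VF (\<rho> k) + (\<Sum>s\<in>UNIV. V (\<rho> k) $ s)) - \<tau> (\<rho> k) *\<^sub>R VF (\<rho> k)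
        - (\<Sum>s\<in>UNIV. (\<tau> (\<rho> k) *\<^sub>R V (\<rho> k)) $ s)) \<longlonglongrightarrow> t0 *\<^sub>R 0 - t0 *\<^sub>R f0 - (\<Sum>s\<in>UNIV. v0 $ s)"
      by (intro tendsto_intros comp lims sub[OF sum0])
    then show ?thesis by (simp add: scaleR_right_distrib scaleR_sum_right)
  qed
  have "t0 \<ge> 0" using lims(1) \<tau>(1) by (intro LIMSEQ_le_const) (auto intro: less_imp_le)
  show thesis
  proof (cases "t0 = 0")
    case False
    with \<open>t0 \<ge> 0\<close> have "t0 > 0" by simp
    have inv: "(\<lambda>k. inverse (\<tau> (\<rho> k))) \<longlonglongrightarrow> inverse t0" using lims(1) False by (rule tendsto_inverse)
    have cancel: "inverse (\<tau> k) *\<^sub>R \<tau> k *\<^sub>R a = a" for k and a :: "'z::real_vector" using \<tau>(1)[of k] by simp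
    have M1: "(\<lambda>k. M (\<rho> k)) \<longlonglongrightarrow> inverse t0 *\<^sub>R m0"
      using tendsto_scaleR[OF inv lims(2)] by (simp only: cancel)
    have V1: "(\<lambda>k. V (\<rho> k)) \<longlonglongrightarrow> inverse t0 *\<^sub>R v0"
      using tendsto_scaleR[OF inv lims(3)] by (simp only: cancel)
    have W1: "(\<lambda>k. W (\<rho> k)) \<longlonglongrightarrow> inverse t0 *\<^sub>R (- t0 *\<^sub>R f0 - (\<Sum>s\<in>UNIV. v0 $ s))"
      using tendsto_scaleR[OF inv limW] by (simp only: cancel)
    show thesis
    \<comment> \<open>The scaling factors have a positive limit, so the multipliers and all
      subgradients converge without scaling; hence the constant 1 for t, and the first
      alternative.\<close>
    proof (rule that[of \<rho> "\<lambda>_. 1" "inverse t0 *\<^sub>R m0" "\<lambda>s. (inverse t0 *\<^sub>R v0) $ s"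
            "inverse t0 *\<^sub>R (- t0 *\<^sub>R f0 - (\<Sum>s\<in>UNIV. v0 $ s))"])
      show "(\<lambda>k. 1 *\<^sub>R M (\<rho> k)) \<longlonglongrightarrow> inverse t0 *\<^sub>R m0" using M1 by simp
      show "(inverse t0 *\<^sub>R v0) $ s \<in> limiting_subdiff (\<lambda>y. ereal ((inverse t0 *\<^sub>R m0) $ s * q s y)) x" for s
        by (rule limiting_subdiff_scaled_limit[OF lipq \<open>\<delta> > 0\<close> sub[OF U, of s] tendsto_vec_nth[OF M1] _ tendsto_vec_nth[OF V1]])
          (use N(4) \<rho>(2) in auto)
      have "f0 \<in> limiting_subdiff (\<lambda>y. ereal (f y)) x"
        by (rule limiting_subdiffI[OF _ sub[OF Y] _ _ lims(4)])
          (use N(3) \<rho>(2) lipschitz_tendsto[OF lipf \<open>\<delta> > 0\<close> sub[OF Y]] in auto)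
      moreover have "inverse t0 *\<^sub>R (- t0 *\<^sub>R f0 - (\<Sum>s\<in>UNIV. v0 $ s)) \<in> limiting_subdiff \<Phi> x"
        by (rule limiting_subdiffI[OF fin sub[OF X(1)] sub[OF X(2)] _ W1]) (use N(1) \<rho>(2) in auto)
      moreover have "f0 + inverse t0 *\<^sub>R (- t0 *\<^sub>R f0 - (\<Sum>s\<in>UNIV. v0 $ s)) + (\<Sum>s\<in>UNIV. (inverse t0 *\<^sub>R v0) $ s) = 0"
        using False by (simp add: scaleR_diff_right scaleR_sum_right)
      ultimately show "(\<exists>vf\<in>limiting_subdiff (\<lambda>y. ereal (f y)) x.
          inverse t0 *\<^sub>R (- t0 *\<^sub>R f0 - (\<Sum>s\<in>UNIV. v0 $ s)) \<in> limiting_subdiff \<Phi> x \<and>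
          vf + inverse t0 *\<^sub>R (- t0 *\<^sub>R f0 - (\<Sum>s\<in>UNIV. v0 $ s)) + (\<Sum>s\<in>UNIV. (inverse t0 *\<^sub>R v0) $ s) = 0) \<or>
        (inverse t0 *\<^sub>R m0 \<noteq> 0 \<and> inverse t0 *\<^sub>R (- t0 *\<^sub>R f0 - (\<Sum>s\<in>UNIV. v0 $ s)) \<in> horizon_subdiff \<Phi> x \<and>
          inverse t0 *\<^sub>R (- t0 *\<^sub>R f0 - (\<Sum>s\<in>UNIV. v0 $ s)) + (\<Sum>s\<in>UNIV. (inverse t0 *\<^sub>R v0) $ s) = 0)"
        by blast
    qed (use \<rho> in auto)
  next
    case True
    show thesis
    proof (rule that[of \<rho> "\<lambda>k. \<tau> (\<rho> k)" m0 "\<lambda>s. v0 $ s" "- (\<Sum>s\<in>UNIV. v0 $ s)"])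
      show "v0 $ s \<in> limiting_subdiff (\<lambda>y. ereal (m0 $ s * q s y)) x" for s
      proof (rule limiting_subdiff_scaled_limit[OF lipq \<open>\<delta> > 0\<close> sub[OF U, of s] comp(2) _ comp(1)], intro always_eventually allI)
        fix k
        show "(\<tau> (\<rho> k) *\<^sub>R V (\<rho> k)) $ s \<in> regular_subdiff (\<lambda>y. ereal ((\<tau> (\<rho> k) *\<^sub>R M (\<rho> k)) $ s * q s y)) (U (\<rho> k) s)"
          using regular_subdiff_scale[OF N(4)[OF \<rho>(2)[of k], of s] \<tau>(1)[of "\<rho> k"]] by (simp add: mult.assoc)
      qed
      \<comment> \<open>The factors \<tau> now tend to 0 and serve as the scalars of the horizon
        subdifferential; the bounded contribution of f vanishes in the limit.\<close>
      have "- (\<Sum>s\<in>UNIV. v0 $ s) \<in> horizon_subdiff \<Phi> x"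
        by (rule horizon_subdiffI[OF fin sub[OF X(1)] sub[OF X(2)], of "\<lambda>k. W (\<rho> k)" "\<lambda>k. \<tau> (\<rho> k)"])
          (use N(1) \<rho>(2) \<tau>(1) lims(1) limW True in \<open>auto intro: less_imp_le\<close>)
      moreover have "m0 \<noteq> 0"
      proof -
        have "(\<lambda>k. norm (\<tau> (\<rho> k) *\<^sub>R M (\<rho> k))) \<longlonglongrightarrow> norm m0" using lims(2) by (rule tendsto_norm)
        moreover have "norm (\<tau> (\<rho> k) *\<^sub>R M (\<rho> k)) = 1 - \<tau> (\<rho> k)" for k using \<tau>[of "\<rho> k"] by simp
        moreover have "(\<lambda>k. 1 - \<tau> (\<rho> k)) \<longlonglongrightarrow> 1 - 0" using lims(1) True by (intro tendsto_intros) simp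
        ultimately have "norm m0 = 1" using LIMSEQ_unique by fastforce
        then show ?thesis by auto
      qed
      ultimately show "(\<exists>vf\<in>limiting_subdiff (\<lambda>y. ereal (f y)) x. - (\<Sum>s\<in>UNIV. v0 $ s) \<in> limiting_subdiff \<Phi> x \<and>
          vf + - (\<Sum>s\<in>UNIV. v0 $ s) + (\<Sum>s\<in>UNIV. v0 $ s) = 0) \<or>
          (m0 \<noteq> 0 \<and> - (\<Sum>s\<in>UNIV. v0 $ s) \<in> horizon_subdiff \<Phi> x \<and> - (\<Sum>s\<in>UNIV. v0 $ s) + (\<Sum>s\<in>UNIV. v0 $ s) = 0)"
        by simp
    qed (use \<rho> lims \<tau>(1,2) in \<open>auto intro: less_imp_le\<close>)
  qed
qed

section \<open>The decoupled penalty method\<close>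

lemma compact_vec_cball:
  fixes c :: "'a::euclidean_space"
  shows "compact {u :: 'a^'s. \<forall>s. u $ s \<in> cball c r}"
proof -
  have "norm u \<le> real CARD('s) * (norm c + r)" if "\<forall>s. u $ s \<in> cball c r" for u :: "'a^'s"
  proof (rule norm_vec_le_card)
    fix s
    have "dist c (u $ s) \<le> r" using that by simp
    then show "norm (u $ s) \<le> norm c + r"
      using norm_triangle_ineq2[of "u $ s" c] by (simp add: dist_norm norm_minus_commute)
  qed
  then have "bounded {u :: 'a^'s. \<forall>s. u $ s \<in> cball c r}" unfolding bounded_iff by blast
  moreover have "closed {u :: 'a^'s. \<forall>s. u $ s \<in> cball c r}"
    unfolding mem_cball by (intro closed_Collect_all closed_Collect_le continuous_intros)
  ultimately show ?thesis by (simp add: compact_eq_bounded_closed)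
qed

text \<open>All terms except \<Phi> are continuous on the product of balls, so the existence result
  applies with the projection to the x block. N is kept apart from k since it will be fixed only
  after k and the wanted precision.\<close>

lemma decoupled_minimizer:
  fixes f :: "real^'d \<Rightarrow> real" and \<theta> :: "'s::finite \<Rightarrow> real^'d \<Rightarrow> real"
  assumes lsc: "lower_semicontinuous \<Phi>" and "\<delta> > 0"
    and cf: "continuous_on (cball c \<delta>) f" and ct: "\<And>s. continuous_on (cball c \<delta>) (\<theta> s)"
  defines "F \<equiv> \<lambda>k N x y (u :: real^'d^'s). \<Phi> x + ereal (f y + k * (\<Sum>s\<in>UNIV. \<theta> s (u $ s))
      + N / 2 * ((y - x) \<bullet> (y - x) + (\<Sum>s\<in>UNIV. (u $ s - x) \<bullet> (u $ s - x))) + (x - c) \<bullet> (x - c) / 2)"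
  shows "\<exists>x y u. x \<in> cball c \<delta> \<and> y \<in> cball c \<delta> \<and> (\<forall>s. u $ s \<in> cball c \<delta>) \<and>
      (\<forall>x'\<in>cball c \<delta>. \<forall>y'\<in>cball c \<delta>. \<forall>u'. (\<forall>s. u' $ s \<in> cball c \<delta>) \<longrightarrow> F k N x y u \<le> F k N x' y' u')"
proof -
  define B where "B = {u :: real^'d^'s. \<forall>s. u $ s \<in> cball c \<delta>}"
  define K where "K = cball c \<delta> \<times> cball c \<delta> \<times> B"
  define G where "G z = (case z of (x, y, u) \<Rightarrow> f y + k * (\<Sum>s\<in>UNIV. \<theta> s (u $ s))
      + N / 2 * ((y - x) \<bullet> (y - x) + (\<Sum>s\<in>UNIV. (u $ s - x) \<bullet> (u $ s - x))) + (x - c) \<bullet> (x - c) / 2)"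
    for z :: "(real^'d) \<times> (real^'d) \<times> (real^'d^'s)"
  have "compact K" unfolding K_def B_def by (intro compact_Times compact_cball compact_vec_cball)
  moreover have "(c, c, \<chi> s. c) \<in> K" using \<open>\<delta> > 0\<close> by (simp add: K_def B_def)
  then have "K \<noteq> {}" by blast
  moreover have "continuous_on K G" unfolding G_def case_prod_beta
  proof (intro continuous_intros)
    show "continuous_on K (\<lambda>p. f (fst (snd p)))"
      by (rule continuous_on_compose2[OF cf]) (auto simp: K_def intro!: continuous_intros)
    show "continuous_on K (\<lambda>p. \<theta> s (snd (snd p) $ s))" for s
      by (rule continuous_on_compose2[OF ct]) (auto simp: K_def B_def intro!: continuous_intros)
  qed auto
  ultimately obtain z where z: "z \<in> K" "\<And>z'. z' \<in> K \<Longrightarrow> \<Phi> (fst z) + ereal (G z) \<le> \<Phi> (fst z') + ereal (G z')"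
    using lower_semicontinuous_attains_min[OF lsc, of K fst G] continuous_on_fst[OF continuous_on_id]
    by (metis (no_types, lifting))
  obtain x y u where xyu: "z = (x, y, u)" by (metis prod_cases3)
  have "F k N x y u \<le> F k N x' y' u'"
    if "x' \<in> cball c \<delta>" "y' \<in> cball c \<delta>" "\<forall>s. u' $ s \<in> cball c \<delta>" for x' y' and u' :: "real^'d^'s"
  proof -
    have "(x', y', u') \<in> K" using that by (simp add: K_def B_def)
    from z(2)[OF this] show ?thesis by (simp add: xyu F_def G_def)
  qed
  moreover have "x \<in> cball c \<delta>" "y \<in> cball c \<delta>" "\<forall>s. u $ s \<in> cball c \<delta>"
    using z(1) by (auto simp: xyu K_def B_def)
  ultimately show ?thesis by blast
qed

lemma has_derivative_half_square:
  "((\<lambda>x. (x - a) \<bullet> (x - a) / 2) has_derivative (\<lambda>z. z \<bullet> (x - a))) (at x)"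
  by (auto intro!: derivative_eq_intros simp: fun_eq_iff inner_commute)

text \<open>Putting all blocks equal to c gives the value \<Phi> c + f c for every k and N. Since
  \<Phi> x + f y is bounded below on the ball, both the penalty and the coupling term at the
  minimisers stay below a constant C. A bounded coupling term with large N brings the copies
  together; a bounded penalty with growing k makes every cluster point z satisfy \<theta> s z = 0.
  Then \<Phi> z + f z + |z - c|^2 / 2 is at most \<Phi> c + f c, and minimality of c yields z =
  c.\<close>

lemma decoupled_penalty_sequence:
  fixes f :: "real^'d \<Rightarrow> real" and \<theta> :: "'s::finite \<Rightarrow> real^'d \<Rightarrow> real"
  assumes ninf: "\<And>x. \<Phi> x \<noteq> -\<infinity>" and lsc: "lower_semicontinuous \<Phi>" and fin: "\<bar>\<Phi> c\<bar> \<noteq> \<infinity>"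
    and "\<delta> > 0"
    and cf: "continuous_on (cball c \<delta>) f" and ct: "\<And>s. continuous_on (cball c \<delta>) (\<theta> s)"
    and t0: "\<And>s x. \<theta> s x \<ge> 0" "\<And>s. \<theta> s c = 0"
    and min: "\<And>x. x \<in> cball c \<delta> \<Longrightarrow> \<forall>s. \<theta> s x = 0 \<Longrightarrow> \<Phi> c + ereal (f c) \<le> \<Phi> x + ereal (f x)"
    and \<epsilon>: "\<And>k. \<epsilon> k > (0::real)"
  obtains r X Y U W VF V where "strict_mono (r :: nat \<Rightarrow> nat)" "X \<longlonglongrightarrow> c" "(\<lambda>k. \<Phi> (X k)) \<longlonglongrightarrow> \<Phi> c"
    "Y \<longlonglongrightarrow> c" "\<And>s. (\<lambda>k. U k $ s) \<longlonglongrightarrow> c"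
    "\<And>k s. dist (U k $ s) (X k) \<le> \<epsilon> (r k)"
    "\<forall>\<^sub>F k in sequentially. W k \<in> regular_subdiff \<Phi> (X k)"
    "\<forall>\<^sub>F k in sequentially. VF k \<in> regular_subdiff (\<lambda>y. ereal (f y)) (Y k)"
    "\<forall>\<^sub>F k in sequentially. \<forall>s. V k $ s \<in> regular_subdiff (\<lambda>y. ereal (real (r k) * \<theta> s y)) (U k $ s :: real^'d)"
    "(\<lambda>k. W k + VF k + (\<Sum>s\<in>UNIV. V k $ s)) \<longlonglongrightarrow> 0"
proof -
  define R where "R N x y u = N / 2 * ((y - x) \<bullet> (y - x) + (\<Sum>s\<in>UNIV. (u $ s - x) \<bullet> (u $ s - x)))"
    for N and x y :: "real^'d" and u :: "real^'d^'s"
  define F where "F k N x y u = \<Phi> x + ereal (f y + k * (\<Sum>s\<in>UNIV. \<theta> s (u $ s)) + R N x y u + (x - c) \<bullet> (x - c) / 2)"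
    for k N :: real and x y :: "real^'d" and u :: "real^'d^'s"
  obtain pc where pc: "\<Phi> c = ereal pc" using fin by auto
  have c: "c \<in> cball c \<delta>" using \<open>\<delta> > 0\<close> by simp
  \<comment> \<open>The sum of the separate minima of \<Phi> and f: they have to be separate because
    the two functions are evaluated at different points.\<close>
  obtain b where b: "\<And>x y. x \<in> cball c \<delta> \<Longrightarrow> y \<in> cball c \<delta> \<Longrightarrow> ereal (b - f y) \<le> \<Phi> x"
  proof -
    have "\<exists>z\<in>cball c \<delta>. \<forall>z'\<in>cball c \<delta>. \<Phi> z + ereal 0 \<le> \<Phi> z' + ereal 0"
      using \<open>\<delta> > 0\<close> by (intro lower_semicontinuous_attains_min[OF lsc, where \<pi> = "\<lambda>x. x"]) auto
    then obtain x0 where "\<forall>x\<in>cball c \<delta>. \<Phi> x0 + ereal 0 \<le> \<Phi> x + ereal 0" by blast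
    then have x0: "\<And>x. x \<in> cball c \<delta> \<Longrightarrow> \<Phi> x0 \<le> \<Phi> x" by (simp add: zero_ereal_def[symmetric])
    obtain y0 where y0: "\<And>y. y \<in> cball c \<delta> \<Longrightarrow> f y0 \<le> f y"
      using continuous_attains_inf[OF compact_cball _ cf] \<open>\<delta> > 0\<close> c by blast
    obtain p0 where p0: "\<Phi> x0 = ereal p0" using x0[OF c] pc ninf[of x0] by (cases "\<Phi> x0") auto
    show thesis
    proof (rule that[of "p0 + f y0"])
      fix x y assume "x \<in> cball c \<delta>" "y \<in> cball c \<delta>"
      with x0[of x] y0[of y] p0 show "ereal (p0 + f y0 - f y) \<le> \<Phi> x"
        by (auto elim!: order_trans[rotated])
    qed
  qed
  \<comment> \<open>The comparison value minus the lower bound; adding 1 makes C positive even when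
    the two coincide.\<close>
  define C where "C = pc + f c - b + 1"
  have "C > 0" using b[OF c c] pc by (simp add: C_def)
  \<comment> \<open>The prescribed precision may stay away from 0, so it is capped by 1/(k+1) to
    bring the copies together in the limit.\<close>
  define \<eta> where "\<eta> k = min (\<epsilon> k) (inverse (real (Suc k)))" for k
  have \<eta>: "\<eta> k > 0" "\<eta> k \<le> \<epsilon> k" "\<eta> k \<le> inverse (real (Suc k))" for k using \<epsilon>[of k] by (auto simp: \<eta>_def)
  \<comment> \<open>With this weight, a coupling term of at most C says exactly that the squared
    distances add up to at most \<eta>^2.\<close>
  define N where "N k = 2 * C / (\<eta> k)\<^sup>2" for k
  have N: "N k > 0" for k using \<eta>(1)[of k] \<open>C > 0\<close> by (simp add: N_def)
  have "\<exists>x y u. x \<in> cball c \<delta> \<and> y \<in> cball c \<delta> \<and> (\<forall>s. u $ s \<in> cball c \<delta>) \<and>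
      (\<forall>x'\<in>cball c \<delta>. \<forall>y'\<in>cball c \<delta>. \<forall>u'. (\<forall>s. u' $ s \<in> cball c \<delta>) \<longrightarrow> F (real k) (N k) x y u \<le> F (real k) (N k) x' y' u')" for k
    unfolding F_def R_def
    by (rule decoupled_minimizer[where \<theta> = \<theta> and k = "real k" and N = "N k", OF lsc \<open>\<delta> > 0\<close> cf ct])
  then obtain X Y U where XYU: "\<And>k. X k \<in> cball c \<delta>" "\<And>k. Y k \<in> cball c \<delta>" "\<And>k s. U k $ s \<in> cball c \<delta>"
    and le: "\<And>k x' y' u'. \<lbrakk>x' \<in> cball c \<delta>; y' \<in> cball c \<delta>; \<forall>s. u' $ s \<in> cball c \<delta>\<rbrakk>
      \<Longrightarrow> F (real k) (N k) (X k) (Y k) (U k) \<le> F (real k) (N k) x' y' u'"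
    by metis
  have S0: "(\<Sum>s\<in>UNIV. \<theta> s (u $ s)) \<ge> 0" for u using t0 by (intro sum_nonneg) auto
  have Sq0: "(\<Sum>s\<in>UNIV. (u $ s - x) \<bullet> (u $ s - x)) \<ge> 0" for x and u :: "real^'d^'s" by (intro sum_nonneg) auto
  have R0: "R (N k) x y u \<ge> 0" for k x y u using N[of k] Sq0 unfolding R_def
    by (intro mult_nonneg_nonneg add_nonneg_nonneg) auto
  have Fc: "F k n c c (\<chi> s. c) = ereal (pc + f c)" for k n by (simp add: F_def R_def pc t0)
  have bound: "\<Phi> (X k) + ereal (f (Y k) + k * (\<Sum>s\<in>UNIV. \<theta> s (U k $ s)) + R (N k) (X k) (Y k) (U k) + (X k - c) \<bullet> (X k - c) / 2)
      \<le> ereal (pc + f c)" for k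
    using le[OF c c, of "\<chi> s. c" k] c unfolding Fc by (simp add: F_def)
  obtain P where P: "\<And>k. \<Phi> (X k) = ereal (P k)"
  proof -
    have "\<exists>p. \<Phi> (X k) = ereal p" for k using bound[of k] ninf[of "X k"] by (cases "\<Phi> (X k)") auto
    then show thesis using that by metis
  qed
  have boundP: "P k + f (Y k) + k * (\<Sum>s\<in>UNIV. \<theta> s (U k $ s)) + R (N k) (X k) (Y k) (U k) + (X k - c) \<bullet> (X k - c) / 2 \<le> pc + f c" for k
    using bound[of k] P[of k] by simp
  have b': "b \<le> P k + f (Y k)" for k using b[OF XYU(1)[of k] XYU(2)[of k]] P[of k] by simp
  have Rle: "R (N k) (X k) (Y k) (U k) \<le> C" for k
    using boundP[of k] b'[of k] S0[of "U k"] inner_ge_zero[of "X k - c"] mult_nonneg_nonneg[of "real k", OF _ S0[of "U k"]]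
    unfolding C_def by linarith
  have sq: "(Y k - X k) \<bullet> (Y k - X k) + (\<Sum>s\<in>UNIV. (U k $ s - X k) \<bullet> (U k $ s - X k)) \<le> (\<eta> k)\<^sup>2" (is "?Q \<le> _") for k
  proof -
    have "C * ?Q \<le> C * (\<eta> k)\<^sup>2"
      using Rle[of k] \<open>C > 0\<close> \<eta>(1)[of k] unfolding R_def N_def by (simp add: field_simps)
    then show ?thesis using \<open>C > 0\<close> by (rule mult_left_le_imp_le)
  qed
  have dY: "dist (Y k) (X k) \<le> \<eta> k" for k
  proof -
    have "(norm (Y k - X k))\<^sup>2 \<le> (\<eta> k)\<^sup>2" using sq[of k] Sq0[of "U k" "X k"] unfolding power2_norm_eq_inner by linarith
    then show ?thesis using \<eta>(1)[of k] by (simp add: dist_norm)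
  qed
  have dU: "dist (U k $ s) (X k) \<le> \<eta> k" for k s
  proof -
    have "(U k $ s - X k) \<bullet> (U k $ s - X k) \<le> (\<Sum>s\<in>UNIV. (U k $ s - X k) \<bullet> (U k $ s - X k))"
      by (rule member_le_sum) auto
    then have "(norm (U k $ s - X k))\<^sup>2 \<le> (\<eta> k)\<^sup>2"
      using sq[of k] inner_ge_zero[of "Y k - X k"] unfolding power2_norm_eq_inner by linarith
    then show ?thesis using \<eta>(1)[of k] by (simp add: dist_norm)
  qed
  have "\<eta> \<longlonglongrightarrow> 0"
  proof (rule tendsto_sandwich[OF _ _ tendsto_const LIMSEQ_inverse_real_of_nat])
    show "\<forall>\<^sub>F n in sequentially. 0 \<le> \<eta> n" by (simp add: \<eta>(1) less_imp_le)
    show "\<forall>\<^sub>F n in sequentially. \<eta> n \<le> inverse (real (Suc n))" by (simp only: \<eta>(3) eventually_True)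
  qed
  obtain z r where z: "z \<in> cball c \<delta>" and r: "strict_mono r" and "(X \<circ> r) \<longlonglongrightarrow> z"
    using compact_cball[of c \<delta>] XYU(1) unfolding compact_def by metis
  then have limX: "(\<lambda>k. X (r k)) \<longlonglongrightarrow> z" by (simp add: o_def)
  have \<eta>r: "(\<lambda>k. \<eta> (r k)) \<longlonglongrightarrow> 0" using LIMSEQ_subseq_LIMSEQ[OF \<open>\<eta> \<longlonglongrightarrow> 0\<close> r] by (simp add: o_def)
  have close: "A \<longlonglongrightarrow> z" if "\<And>k. dist (A k) (X (r k)) \<le> \<eta> (r k)" for A
  proof -
    have "(\<lambda>k. A k - X (r k)) \<longlonglongrightarrow> 0"
      by (rule Lim_null_comparison[OF _ \<eta>r]) (use that in \<open>auto simp: dist_norm\<close>)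
    from tendsto_add[OF this limX] show ?thesis by simp
  qed
  have limY: "(\<lambda>k. Y (r k)) \<longlonglongrightarrow> z" and limU: "\<And>s. (\<lambda>k. U (r k) $ s) \<longlonglongrightarrow> z"
    using close dY dU by auto
  have limf: "(\<lambda>k. f (Y (r k))) \<longlonglongrightarrow> f z"
    by (rule continuous_on_tendsto_compose[OF cf limY z]) (use XYU in auto)
  \<comment> \<open>The penalty bound reads r k * \<theta> <= C, and r k >= k for a strictly
    increasing r.\<close>
  have "\<theta> s z = 0" for s
  proof -
    have limt: "(\<lambda>k. \<theta> s (U (r k) $ s)) \<longlonglongrightarrow> \<theta> s z"
      by (rule continuous_on_tendsto_compose[OF ct limU z]) (use XYU in auto)
    have "\<forall>\<^sub>F k in sequentially. norm (\<theta> s (U (r k) $ s)) \<le> C * inverse (real k)"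
      using eventually_gt_at_top[of 0]
    proof eventually_elim
      case (elim k)
      have "real (r k) * \<theta> s (U (r k) $ s) \<le> real (r k) * (\<Sum>s\<in>UNIV. \<theta> s (U (r k) $ s))"
        using t0 by (intro mult_left_mono member_le_sum) auto
      also have "\<dots> \<le> C"
        using boundP[of "r k"] b'[of "r k"] R0[of "r k" "X (r k)" "Y (r k)" "U (r k)"] inner_ge_zero[of "X (r k) - c"]
        unfolding C_def by linarith
      finally have "real (r k) * \<theta> s (U (r k) $ s) \<le> C" .
      moreover have "real k \<le> real (r k)" using seq_suble[OF r] by simp
      ultimately have "real k * \<theta> s (U (r k) $ s) \<le> C"
        using mult_right_mono[of "real k" "real (r k)" "\<theta> s (U (r k) $ s)"] t0(1) by fastforce
      then show ?case using elim t0(1) by (simp add: field_simps)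
    qed
    moreover have "(\<lambda>k. C * inverse (real k)) \<longlonglongrightarrow> 0"
      using tendsto_mult[OF tendsto_const lim_inverse_n, of C] by simp
    ultimately have "(\<lambda>k. \<theta> s (U (r k) $ s)) \<longlonglongrightarrow> 0" by (rule Lim_null_comparison)
    with limt show ?thesis by (rule LIMSEQ_unique)
  qed
  with min[OF z] have minz: "\<Phi> c + ereal (f c) \<le> \<Phi> z + ereal (f z)" by blast
  have "\<Phi> z \<le> ereal (pc + f c - f z - (z - c) \<bullet> (z - c) / 2)"
  proof (rule lower_semicontinuous_sequentially[OF lsc limX])
    show "\<Phi> (X (r k)) \<le> ereal (pc + f c - f (Y (r k)) - (X (r k) - c) \<bullet> (X (r k) - c) / 2)" for k
      using boundP[of "r k"] R0[of "r k" "X (r k)" "Y (r k)" "U (r k)"] mult_nonneg_nonneg[of "real (r k)", OF _ S0[of "U (r k)"]]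
      unfolding P by simp
    show "(\<lambda>k. ereal (pc + f c - f (Y (r k)) - (X (r k) - c) \<bullet> (X (r k) - c) / 2)) \<longlonglongrightarrow>
        ereal (pc + f c - f z - (z - c) \<bullet> (z - c) / 2)"
      by (intro tendsto_intros limf limX) auto
  qed
  with minz pc have "(z - c) \<bullet> (z - c) \<le> 0" by (cases "\<Phi> z") auto
  then have zc: "z = c" using inner_gt_zero_iff[of "z - c"] by fastforce
  have lim\<Phi>: "(\<lambda>k. \<Phi> (X (r k))) \<longlonglongrightarrow> \<Phi> c"
  proof (rule order_tendstoI)
    fix a assume "a < \<Phi> c"
    show "\<forall>\<^sub>F k in sequentially. a < \<Phi> (X (r k))"
      by (rule eventually_compose_filterlim[OF lower_semicontinuous_sublevel[OF lsc \<open>a < \<Phi> c\<close>] limX[unfolded zc]])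
  next
    fix a assume a: "\<Phi> c < a"
    have "(\<lambda>k. ereal (pc + f c - f (Y (r k)))) \<longlonglongrightarrow> ereal (pc + f c - f c)"
      by (intro tendsto_intros limf[unfolded zc])
    then have "\<forall>\<^sub>F k in sequentially. ereal (pc + f c - f (Y (r k))) < a"
      using a pc by (intro order_tendstoD(2)) auto
    then show "\<forall>\<^sub>F k in sequentially. \<Phi> (X (r k)) < a"
    proof eventually_elim
      case (elim k)
      have "\<Phi> (X (r k)) \<le> ereal (pc + f c - f (Y (r k)))"
        using boundP[of "r k"] R0[of "r k" "X (r k)" "Y (r k)" "U (r k)"] inner_ge_zero[of "X (r k) - c"]
          mult_nonneg_nonneg[of "real (r k)", OF _ S0[of "U (r k)"]]
        unfolding P ereal_less_eq by linarith
      with elim show ?case by order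
    qed
  qed
  \<comment> \<open>\<open>VF\<close> and \<open>V\<close> are the negative gradients of the
    coupling terms in their own blocks. The same terms occur with opposite sign in the x block, so
    the sum of all subgradients collapses to c - X k, the negative gradient of the squared
    distance.\<close>
  define VF where "VF k = N k *\<^sub>R (X k - Y k)" for k
  define V where "V k = (\<chi> s. N k *\<^sub>R (X k - U k $ s))" for k
  define W where "W k = c - X k - VF k - (\<Sum>s\<in>UNIV. V k $ s)" for k
  have W: "W k \<in> regular_subdiff \<Phi> (X k)" if "X k \<in> ball c \<delta>" for k
  proof -
    have "- ((X k - c) + N k *\<^sub>R ((X k - Y k) + (\<Sum>s\<in>UNIV. X k - U k $ s))) \<in> regular_subdiff \<Phi> (X k)"
    proof (rule regular_subdiff_local_min[where p = "\<lambda>x. R (N k) x (Y k) (U k) + (x - c) \<bullet> (x - c) / 2"])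
      have "\<forall>\<^sub>F x in nhds (X k). x \<in> ball c \<delta>" using that by (intro eventually_nhds_in_open) auto
      then show "\<forall>\<^sub>F x in nhds (X k). \<Phi> (X k) + ereal (R (N k) (X k) (Y k) (U k) + (X k - c) \<bullet> (X k - c) / 2)
          \<le> \<Phi> x + ereal (R (N k) x (Y k) (U k) + (x - c) \<bullet> (x - c) / 2)"
      proof eventually_elim
        case (elim x)
        then show ?case using le[of x "Y k" "U k" k] XYU ninf[of x] P[of k] unfolding F_def
          by (cases "\<Phi> x") auto
      qed
      show "((\<lambda>x. R (N k) x (Y k) (U k) + (x - c) \<bullet> (x - c) / 2) has_derivative
         (\<lambda>z. z \<bullet> ((X k - c) + N k *\<^sub>R ((X k - Y k) + (\<Sum>s\<in>UNIV. X k - U k $ s))))) (at (X k))"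
      proof -
        have "R (N k) x (Y k) (U k) = N k * ((x - Y k) \<bullet> (x - Y k) / 2 + (\<Sum>s\<in>UNIV. (x - U k $ s) \<bullet> (x - U k $ s) / 2))" for x
          unfolding R_def dot_square_norm norm_minus_commute[of _ x]
          by (simp add: sum_divide_distrib[symmetric] add_divide_distrib[symmetric])
        moreover have "((\<lambda>x. N k * ((x - Y k) \<bullet> (x - Y k) / 2 + (\<Sum>s\<in>UNIV. (x - U k $ s) \<bullet> (x - U k $ s) / 2)) + (x - c) \<bullet> (x - c) / 2)
            has_derivative (\<lambda>z. N k * (z \<bullet> (X k - Y k) + (\<Sum>s\<in>UNIV. z \<bullet> (X k - U k $ s))) + z \<bullet> (X k - c))) (at (X k))"
          by (intro has_derivative_add has_derivative_mult_right has_derivative_sum has_derivative_half_square)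
        ultimately show ?thesis
          by (simp only: inner_add_right inner_scaleR_right inner_sum_right add.commute)
      qed
    qed (use ninf P in auto)
    moreover have "- ((X k - c) + N k *\<^sub>R ((X k - Y k) + (\<Sum>s\<in>UNIV. X k - U k $ s))) = W k"
      by (simp add: W_def VF_def V_def scaleR_add_right scaleR_sum_right)
    ultimately show ?thesis by simp
  qed
  have VF: "VF k \<in> regular_subdiff (\<lambda>y. ereal (f y)) (Y k)" if "Y k \<in> ball c \<delta>" for k
  proof -
    have "- (N k *\<^sub>R (Y k - X k)) \<in> regular_subdiff (\<lambda>y. ereal (f y)) (Y k)"
    proof (rule regular_subdiff_local_min[where p = "\<lambda>y. N k / 2 * ((y - X k) \<bullet> (y - X k))"])
      have "\<forall>\<^sub>F y in nhds (Y k). y \<in> ball c \<delta>" using that by (intro eventually_nhds_in_open) auto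
      then show "\<forall>\<^sub>F y in nhds (Y k). ereal (f (Y k)) + ereal (N k / 2 * ((Y k - X k) \<bullet> (Y k - X k)))
          \<le> ereal (f y) + ereal (N k / 2 * ((y - X k) \<bullet> (y - X k)))"
      proof eventually_elim
        case (elim y)
        then show ?case using le[of "X k" y "U k" k] XYU P[of k] unfolding F_def R_def
          by (auto simp: distrib_left)
      qed
      show "((\<lambda>y. N k / 2 * ((y - X k) \<bullet> (y - X k))) has_derivative (\<lambda>z. z \<bullet> (N k *\<^sub>R (Y k - X k)))) (at (Y k))"
        by (auto intro!: derivative_eq_intros simp: fun_eq_iff inner_commute algebra_simps)
    qed auto
    then show ?thesis by (simp add: VF_def scaleR_diff_right)
  qed
  have V: "V k $ s \<in> regular_subdiff (\<lambda>y. ereal (real k * \<theta> s y)) (U k $ s)" if "U k $ s \<in> ball c \<delta>" for k s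
  proof -
    have "- (N k *\<^sub>R (U k $ s - X k)) \<in> regular_subdiff (\<lambda>y. ereal (real k * \<theta> s y)) (U k $ s)"
    proof (rule regular_subdiff_local_min[where p = "\<lambda>y. N k / 2 * ((y - X k) \<bullet> (y - X k))"])
      have "\<forall>\<^sub>F y in nhds (U k $ s). y \<in> ball c \<delta>" using that by (intro eventually_nhds_in_open) auto
      then show "\<forall>\<^sub>F y in nhds (U k $ s). ereal (real k * \<theta> s (U k $ s)) + ereal (N k / 2 * ((U k $ s - X k) \<bullet> (U k $ s - X k)))
          \<le> ereal (real k * \<theta> s y) + ereal (N k / 2 * ((y - X k) \<bullet> (y - X k)))"
      proof eventually_elim
        case (elim y)
        \<comment> \<open>Only the copy belonging to s is moved. In the comparison all other
          summands cancel, which is expressed by \<open>upd\<close>.\<close>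
        define u where "u = (\<chi> s'. if s' = s then y else U k $ s')"
        have upd: "(\<Sum>s'\<in>UNIV. h s' (u $ s')) = h s y - h s (U k $ s) + (\<Sum>s'\<in>UNIV. h s' (U k $ s'))" for h :: "'s \<Rightarrow> real^'d \<Rightarrow> real"
          unfolding sum.remove[of UNIV s "\<lambda>s'. h s' (u $ s')", OF finite UNIV_I]
            sum.remove[of UNIV s "\<lambda>s'. h s' (U k $ s')", OF finite UNIV_I]
          by (simp add: u_def)
        have "F (real k) (N k) (X k) (Y k) (U k) \<le> F (real k) (N k) (X k) (Y k) u"
          by (rule le) (use XYU elim in \<open>auto simp: u_def\<close>)
        then show ?case
          unfolding F_def R_def upd[of \<theta>] upd[of "\<lambda>_ v. (v - X k) \<bullet> (v - X k)"] P[of k]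
          by (simp add: distrib_left right_diff_distrib)
      qed
      show "((\<lambda>y. N k / 2 * ((y - X k) \<bullet> (y - X k))) has_derivative (\<lambda>z. z \<bullet> (N k *\<^sub>R (U k $ s - X k)))) (at (U k $ s))"
        by (auto intro!: derivative_eq_intros simp: fun_eq_iff inner_commute algebra_simps)
    qed auto
    then show ?thesis by (simp add: V_def scaleR_diff_right)
  qed
  have ev: "\<forall>\<^sub>F k in sequentially. A k \<in> ball c \<delta>" if "A \<longlonglongrightarrow> z" for A
    using that \<open>\<delta> > 0\<close> unfolding zc by (intro topological_tendstoD) auto
  show thesis
  proof (rule that[of r "\<lambda>k. X (r k)" "\<lambda>k. Y (r k)" "\<lambda>k. U (r k)" "\<lambda>k. W (r k)" "\<lambda>k. VF (r k)" "\<lambda>k. V (r k)"])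
    show "dist (U (r k) $ s) (X (r k)) \<le> \<epsilon> (r k)" for k s using dU[of "r k" s] \<eta>(2)[of "r k"] by linarith
    show "\<forall>\<^sub>F k in sequentially. W (r k) \<in> regular_subdiff \<Phi> (X (r k))"
      using ev[OF limX] by eventually_elim (rule W)
    show "\<forall>\<^sub>F k in sequentially. VF (r k) \<in> regular_subdiff (\<lambda>y. ereal (f y)) (Y (r k))"
      using ev[OF limY] by eventually_elim (rule VF)
    show "\<forall>\<^sub>F k in sequentially. \<forall>s. V (r k) $ s \<in> regular_subdiff (\<lambda>y. ereal (real (r k) * \<theta> s y)) (U (r k) $ s)"
    proof (rule eventually_all_finite)
      fix s
      show "\<forall>\<^sub>F k in sequentially. V (r k) $ s \<in> regular_subdiff (\<lambda>y. ereal (real (r k) * \<theta> s y)) (U (r k) $ s)"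
        using ev[OF limU] by eventually_elim (rule V)
    qed
    have "(\<lambda>k. c - X (r k)) \<longlonglongrightarrow> c - c" using limX unfolding zc by (intro tendsto_intros)
    then show "(\<lambda>k. W (r k) + VF (r k) + (\<Sum>s\<in>UNIV. V (r k) $ s)) \<longlonglongrightarrow> 0" by (simp add: W_def)
  qed (use r limX limY limU lim\<Phi> zc in auto)
qed

section \<open>Inequalities and equalities as one family of constraints\<close>

definition constraint :: "(real^'d \<Rightarrow> real^'n) \<Rightarrow> (real^'d \<Rightarrow> real^'m) \<Rightarrow> 'n + 'm \<Rightarrow> real^'d \<Rightarrow> real" where
  "constraint g h s x = (case s of Inl i \<Rightarrow> g x $ i | Inr j \<Rightarrow> h x $ j)"

text \<open>The violation, one-sided for inequalities and signed for equalities, so that k times it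
  carries the sign required of the multiplier. Indexing by the sum type makes all multipliers one
  vector, whose norm is the quantity to normalise by.\<close>

definition residual :: "'n + 'm \<Rightarrow> real \<Rightarrow> real" where
  "residual s t = (case s of Inl i \<Rightarrow> max 0 t | Inr j \<Rightarrow> t)"

lemma feasible_set_iff:
  fixes g :: "real^'d \<Rightarrow> real^'n" and h :: "real^'d \<Rightarrow> real^'m"
  shows "x \<in> feasible_set g h \<longleftrightarrow> (\<forall>s. residual s (constraint g h s x) = 0)"
proof -
  have "(\<forall>s. residual s (constraint g h s x) = 0) \<longleftrightarrow>
      (\<forall>i. residual (Inl i :: 'n + 'm) (constraint g h (Inl i) x) = 0) \<and> (\<forall>j. residual (Inr j :: 'n + 'm) (constraint g h (Inr j) x) = 0)"
    by (metis sum.exhaust)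
  also have "\<dots> \<longleftrightarrow> (\<forall>i. g x $ i \<le> 0) \<and> h x = 0"
    by (simp add: residual_def constraint_def vec_eq_iff flip: max.absorb_iff1)
  finally show ?thesis by (simp add: feasible_set_def)
qed

lemma residual_lipschitz: "\<bar>residual s a - residual s b\<bar> \<le> \<bar>a - b\<bar>"
  by (auto simp: residual_def split: sum.split)

text \<open>Squaring removes the kink of the positive part: whatever the signs of y and t, the
  linearisation error is at most (y - t)^2 / 2. For opposite signs this is an estimate, for two
  nonnegative numbers an identity, and for two negative ones the error is 0.\<close>

lemma has_real_derivative_half_square_residual:
  "((\<lambda>t. k * ((residual s t)\<^sup>2 / 2)) has_real_derivative k * residual s t) (at t)"
proof -
  have "((\<lambda>t. (residual s t)\<^sup>2 / 2) has_real_derivative residual s t) (at t)"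
    unfolding has_field_derivative_def
  proof (rule has_derivativeI_sandwich[where e = 1 and H = "\<lambda>y. \<bar>y - t\<bar> / 2"])
    fix y :: real assume "y \<noteq> t"
    have eq: "y\<^sup>2 / 2 - t\<^sup>2 / 2 - t * (y - t) = (y - t)\<^sup>2 / 2" by (simp add: field_simps power2_eq_square)
    have sq: "\<bar>y\<^sup>2 / 2 - t\<^sup>2 / 2 - t * (y - t)\<bar> \<le> (y - t)\<^sup>2 / 2" unfolding eq by simp
    have "\<bar>(max 0 y)\<^sup>2 / 2 - (max 0 t)\<^sup>2 / 2 - max 0 t * (y - t)\<bar> \<le> (y - t)\<^sup>2 / 2"
    proof (cases "t \<ge> 0"; cases "y \<ge> 0")
      assume "t \<ge> 0" "\<not> y \<ge> 0"
      have "y\<^sup>2 \<ge> 0" "t * y \<le> 0" "t\<^sup>2 \<ge> 0" using \<open>t \<ge> 0\<close> \<open>\<not> y \<ge> 0\<close> by (auto simp: mult_le_0_iff)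
      moreover have "(max 0 y)\<^sup>2 / 2 - (max 0 t)\<^sup>2 / 2 - max 0 t * (y - t) = t\<^sup>2 / 2 - t * y"
        using \<open>t \<ge> 0\<close> \<open>\<not> y \<ge> 0\<close> by (simp add: field_simps power2_eq_square)
      moreover have "(y - t)\<^sup>2 / 2 = y\<^sup>2 / 2 - t * y + t\<^sup>2 / 2" by (simp add: field_simps power2_eq_square)
      ultimately show ?thesis unfolding abs_le_iff by linarith
    next
      assume "\<not> t \<ge> 0" "y \<ge> 0"
      then have "y\<^sup>2 \<le> (y - t)\<^sup>2" by (intro power_mono) auto
      then show ?thesis using \<open>\<not> t \<ge> 0\<close> \<open>y \<ge> 0\<close> by simp
    next
      assume "t \<ge> 0" "y \<ge> 0"
      then show ?thesis using sq by (simp only: max_absorb2)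
    qed auto
    with sq have "norm ((residual s y)\<^sup>2 / 2 - (residual s t)\<^sup>2 / 2 - residual s t * (y - t)) \<le> (y - t)\<^sup>2 / 2"
      by (auto simp: residual_def split: sum.split)
    also have "\<dots> = \<bar>y - t\<bar> / 2 * norm (y - t)" by (simp add: power2_eq_square flip: abs_mult)
    finally show "norm ((residual s y)\<^sup>2 / 2 - (residual s t)\<^sup>2 / 2 - residual s t * (y - t)) / norm (y - t) \<le> \<bar>y - t\<bar> / 2"
      using \<open>y \<noteq> t\<close> by (simp add: divide_le_eq)
  next
    show "((\<lambda>y. \<bar>y - t\<bar> / 2) \<longlongrightarrow> 0) (at t)" by (auto intro!: tendsto_eq_intros)
  qed (auto intro: bounded_linear_mult_right)
  then show ?thesis by (rule DERIV_cmult)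
qed

lemma lipschitz_constraint:
  assumes "Lg-lipschitz_on S g" and "Lh-lipschitz_on S h"
  shows "(max Lg Lh)-lipschitz_on S (constraint g h s)"
proof (rule lipschitz_onI)
  fix x y assume xy: "x \<in> S" "y \<in> S"
  have "dist (constraint g h s x) (constraint g h s y) \<le> max (dist (g x) (g y)) (dist (h x) (h y))"
    by (auto simp: constraint_def le_max_iff_disj dist_vec_nth_le split: sum.split)
  also have "\<dots> \<le> max (Lg * dist x y) (Lh * dist x y)"
    using lipschitz_onD[OF assms(1) xy] lipschitz_onD[OF assms(2) xy] by (intro max.mono)
  also have "\<dots> \<le> max Lg Lh * dist x y" by (auto intro: mult_right_mono)
  finally show "dist (constraint g h s x) (constraint g h s y) \<le> max Lg Lh * dist x y" .
qed (use lipschitz_on_nonneg[OF assms(1)] in auto)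

text \<open>The penalty functions are half squared residuals; linearising the square at the copy
  \<open>U k $ s\<close> turns a subgradient of the penalty into one of a multiple of the
  constraint. The factor involves the residual at the copy, not at \<open>X k\<close>; \<epsilon> is
  left open so that each application can control that difference.\<close>

lemma approximate_kkt_sequence:
  fixes f :: "real^'d \<Rightarrow> real" and g :: "real^'d \<Rightarrow> real^'n" and h :: "real^'d \<Rightarrow> real^'m"
  assumes ninf: "\<And>x. \<Phi> x \<noteq> - \<infinity>" and lsc: "lower_semicontinuous \<Phi>" and fin: "\<bar>\<Phi> c\<bar> \<noteq> \<infinity>"
    and loc: "local_minimizer (\<lambda>x. ereal (f x) + \<Phi> x) (feasible_set g h) c"
    and "lipschitz_around f c" "lipschitz_around g c" "lipschitz_around h c"
    and \<epsilon>: "\<And>k. \<epsilon> k > (0::real)"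
  obtains \<delta> Lf L r X Y U W VF V M where "\<delta> > 0" "Lf-lipschitz_on (cball c \<delta>) f"
    "\<And>s. L-lipschitz_on (cball c \<delta>) (constraint g h s)"
    "strict_mono (r :: nat \<Rightarrow> nat)" "X \<longlonglongrightarrow> c" "(\<lambda>k. \<Phi> (X k)) \<longlonglongrightarrow> \<Phi> c"
    "Y \<longlonglongrightarrow> c" "\<And>s. (\<lambda>k. U k $ s) \<longlonglongrightarrow> c"
    "\<And>k s. dist (U k $ s) (X k) \<le> \<epsilon> (r k)"
    "\<And>k s. M k $ s = real (r k) * residual s (constraint g h s (U k $ s))"
    "\<forall>\<^sub>F k in sequentially. W k \<in> regular_subdiff \<Phi> (X k)"
    "\<forall>\<^sub>F k in sequentially. VF k \<in> regular_subdiff (\<lambda>y. ereal (f y)) (Y k)"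
    "\<forall>\<^sub>F k in sequentially. \<forall>s. V k $ s \<in> regular_subdiff (\<lambda>y. ereal (M k $ s * constraint g h s y)) (U k $ s)"
    "(\<lambda>k. W k + VF k + (\<Sum>s\<in>UNIV. V k $ s)) \<longlonglongrightarrow> 0"
proof -
  obtain d1 d2 d3 d4 Lf Lg Lh where d: "d1 > 0" "d2 > 0" "d3 > 0" "d4 > 0"
    and lip: "Lf-lipschitz_on (cball c d1) f" "Lg-lipschitz_on (cball c d2) g" "Lh-lipschitz_on (cball c d3) h"
    and min: "\<And>y. y \<in> feasible_set g h \<inter> ball c d4 \<Longrightarrow> ereal (f c) + \<Phi> c \<le> ereal (f y) + \<Phi> y"
    using assms unfolding lipschitz_around_def local_minimizer_def by metis
  \<comment> \<open>Local minimality is given on an open ball and used on a closed one, hence d4 /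
    2.\<close>
  define \<delta> where "\<delta> = Min {d1, d2, d3, d4 / 2}"
  have \<delta>: "\<delta> > 0" "\<delta> \<le> d1" "\<delta> \<le> d2" "\<delta> \<le> d3" "\<delta> < d4" using d by (auto simp: \<delta>_def)
  have lipf: "Lf-lipschitz_on (cball c \<delta>) f" using lip(1) \<delta> by (auto intro: lipschitz_on_subset)
  have lipq: "(max Lg Lh)-lipschitz_on (cball c \<delta>) (constraint g h s)" for s
    using lip(2,3) \<delta> by (intro lipschitz_constraint) (auto intro: lipschitz_on_subset)
  define \<theta> where "\<theta> s x = (residual s (constraint g h s x))\<^sup>2 / 2" for s x
  have c\<theta>: "continuous_on (cball c \<delta>) (\<theta> s)" for s
  proof -
    have "continuous_on (cball c \<delta>) (\<lambda>x. residual s (constraint g h s x))"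
      using lipschitz_on_continuous_on[OF lipq[of s]]
      by (cases s) (auto simp: residual_def intro!: continuous_intros)
    then show ?thesis unfolding \<theta>_def by (intro continuous_intros) auto
  qed
  have feas: "x \<in> feasible_set g h \<longleftrightarrow> (\<forall>s. \<theta> s x = 0)" for x
    unfolding feasible_set_iff \<theta>_def by simp
  have "c \<in> feasible_set g h" using loc unfolding local_minimizer_def by blast
  then have \<theta>c: "\<theta> s c = 0" for s unfolding feas by blast
  have min': "\<Phi> c + ereal (f c) \<le> \<Phi> x + ereal (f x)" if "x \<in> cball c \<delta>" "\<forall>s. \<theta> s x = 0" for x
    using min[of x] that \<delta>(5) feas[of x] by (simp add: add.commute)
  have \<theta>0: "\<theta> s x \<ge> 0" for s x by (simp add: \<theta>_def)
  obtain r X Y U W VF V where seq: "strict_mono (r :: nat \<Rightarrow> nat)" "X \<longlonglongrightarrow> c" "(\<lambda>k. \<Phi> (X k)) \<longlonglongrightarrow> \<Phi> c"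
    "Y \<longlonglongrightarrow> c" "\<And>s. (\<lambda>k. U k $ s) \<longlonglongrightarrow> c"
    "\<And>k s. dist (U k $ s) (X k) \<le> \<epsilon> (r k)"
    "\<forall>\<^sub>F k in sequentially. W k \<in> regular_subdiff \<Phi> (X k)"
    "\<forall>\<^sub>F k in sequentially. VF k \<in> regular_subdiff (\<lambda>y. ereal (f y)) (Y k)"
    "\<forall>\<^sub>F k in sequentially. \<forall>s. V k $ s \<in> regular_subdiff (\<lambda>y. ereal (real (r k) * \<theta> s y)) (U k $ s)"
    "(\<lambda>k. W k + VF k + (\<Sum>s\<in>UNIV. V k $ s)) \<longlonglongrightarrow> 0"
    using decoupled_penalty_sequence[where \<theta> = \<theta> and \<epsilon> = \<epsilon>, OF ninf lsc fin \<delta>(1) lipschitz_on_continuous_on[OF lipf] c\<theta> \<theta>0 \<theta>c min' \<epsilon>]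
    by blast
  define M where "M k = (\<chi> s. real (r k) * residual s (constraint g h s (U k $ s)))" for k
  have "\<forall>\<^sub>F k in sequentially. \<forall>s. U k $ s \<in> ball c \<delta>"
    by (rule eventually_all_finite) (use seq(5) \<delta>(1) in \<open>intro topological_tendstoD, auto\<close>)
  with seq(9) have "\<forall>\<^sub>F k in sequentially. \<forall>s. V k $ s \<in> regular_subdiff (\<lambda>y. ereal (M k $ s * constraint g h s y)) (U k $ s)"
  proof eventually_elim
    case (elim k)
    show ?case
    proof
      fix s
      have "M k $ s = real (r k) * residual s (constraint g h s (U k $ s))" by (simp add: M_def)
      then show "V k $ s \<in> regular_subdiff (\<lambda>y. ereal (M k $ s * constraint g h s y)) (U k $ s)"
        using elim unfolding \<theta>_def
        by (simp only:) (rule regular_subdiff_chain[OF _ lipq _ has_real_derivative_half_square_residual], auto)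
    qed
  qed
  then show thesis
    by (intro that[of \<delta> Lf "max Lg Lh" r X Y U M W VF V]) (use \<delta>(1) lipf lipq seq in \<open>auto simp: M_def\<close>)
qed

text \<open>Here \<open>a\<close> stands for the value of the constraint at the limit point: if it
  is negative, the estimates are eventually 0 and so is their scaled limit. Stated for arbitrary
  \<open>M\<close>, because it is applied both to the penalty multipliers and to the reduced
  ones.\<close>

lemma multiplier_limit_complementary:
  fixes M :: "nat \<Rightarrow> real^('n::finite + 'm::finite)"
  assumes "strict_mono \<rho>" "\<And>k. t k \<ge> 0" "(\<lambda>k. t k *\<^sub>R M (\<rho> k)) \<longlonglongrightarrow> m"
    and "\<forall>\<^sub>F k in sequentially. M k $ s \<ge> 0" and "a < 0 \<Longrightarrow> \<forall>\<^sub>F k in sequentially. M k $ s = 0" and "a \<le> 0"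
  shows "m $ s \<ge> 0 \<and> m $ s * a = 0"
proof
  have lim: "(\<lambda>k. t k * M (\<rho> k) $ s) \<longlonglongrightarrow> m $ s" using tendsto_vec_nth[OF assms(3), of s] by simp
  have "\<forall>\<^sub>F k in sequentially. M (\<rho> k) $ s \<ge> 0" using assms(1,4) by (rule eventually_subseq)
  then have "\<forall>\<^sub>F k in sequentially. 0 \<le> t k * M (\<rho> k) $ s"
    by eventually_elim (use assms(2) in simp)
  with lim show "m $ s \<ge> 0" by (intro tendsto_lowerbound) auto
  have "m $ s = 0" if "a < 0"
  proof -
    have "\<forall>\<^sub>F k in sequentially. M (\<rho> k) $ s = 0"
      using assms(1) assms(5)[OF that] by (rule eventually_subseq)
    then have "\<forall>\<^sub>F k in sequentially. t k * M (\<rho> k) $ s = 0" by eventually_elim simp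
    then have "(\<lambda>k. t k * M (\<rho> k) $ s) \<longlonglongrightarrow> 0" by (rule tendsto_eventually)
    with lim show ?thesis by (rule LIMSEQ_unique)
  qed
  then show "m $ s * a = 0" using assms(6) by fastforce
qed

lemma sum_UNIV_Plus:
  fixes F :: "'n::finite + 'm::finite \<Rightarrow> 'a::comm_monoid_add"
  shows "(\<Sum>s\<in>UNIV. F s) = (\<Sum>i\<in>UNIV. F (Inl i)) + (\<Sum>j\<in>UNIV. F (Inr j))"
  using sum.Plus[of "UNIV :: 'n set" "UNIV :: 'm set" F] by simp

text \<open>Splits the single family into the two Minkowski sums of the KKT conditions. Nonnegative
  multipliers can be taken out of the subdifferential; those of the equalities have free sign and
  stay inside.\<close>

lemma constraint_subgradients_sum:
  fixes g :: "real^'d \<Rightarrow> real^'n" and h :: "real^'d \<Rightarrow> real^'m" and m :: "real^('n + 'm)"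
  assumes "\<delta> > 0" and lip: "\<And>s. L-lipschitz_on (cball x \<delta>) (constraint g h s)"
    and m: "\<And>i. m $ Inl i \<ge> 0"
    and v: "\<And>s. v s \<in> limiting_subdiff (\<lambda>y. ereal (m $ s * constraint g h s y)) x"
  shows "\<exists>a\<in>\<Sum>i\<in>UNIV. (\<lambda>w. m $ Inl i *\<^sub>R w) ` limiting_subdiff (\<lambda>y. ereal (g y $ i)) x.
    \<exists>b\<in>\<Sum>j\<in>UNIV. limiting_subdiff (\<lambda>y. ereal (m $ Inr j * h y $ j)) x. (\<Sum>s\<in>UNIV. v s) = a + b"
proof (intro bexI)
  have "v (Inl i) \<in> (\<lambda>w. m $ Inl i *\<^sub>R w) ` limiting_subdiff (\<lambda>y. ereal (g y $ i)) x" for i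
    using limiting_subdiff_scaled_subset[OF lip \<open>\<delta> > 0\<close> m v[of "Inl i"]] by (simp add: constraint_def)
  then show "(\<Sum>i\<in>UNIV. v (Inl i)) \<in> (\<Sum>i\<in>UNIV. (\<lambda>w. m $ Inl i *\<^sub>R w) ` limiting_subdiff (\<lambda>y. ereal (g y $ i)) x)"
    by (subst set_sum_alt) auto
  have "v (Inr j) \<in> limiting_subdiff (\<lambda>y. ereal (m $ Inr j * h y $ j)) x" for j
    using v[of "Inr j"] by (simp add: constraint_def)
  then show "(\<Sum>j\<in>UNIV. v (Inr j)) \<in> (\<Sum>j\<in>UNIV. limiting_subdiff (\<lambda>y. ereal (m $ Inr j * h y $ j)) x)"
    by (subst set_sum_alt) auto
  show "(\<Sum>s\<in>UNIV. v s) = (\<Sum>i\<in>UNIV. v (Inl i)) + (\<Sum>j\<in>UNIV. v (Inr j))"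
    by (rule sum_UNIV_Plus)
qed

lemma kkt_pointI:
  fixes g :: "real^'d \<Rightarrow> real^'n" and h :: "real^'d \<Rightarrow> real^'m" and m :: "real^('n + 'm)"
  assumes "\<delta> > 0" and lip: "\<And>s. L-lipschitz_on (cball x \<delta>) (constraint g h s)"
    and m: "\<And>i. m $ Inl i \<ge> 0 \<and> m $ Inl i * g x $ i = 0"
    and v: "\<And>s. v s \<in> limiting_subdiff (\<lambda>y. ereal (m $ s * constraint g h s y)) x"
    and "vf \<in> limiting_subdiff (\<lambda>y. ereal (f y)) x" "w \<in> limiting_subdiff \<Phi> x"
    and "vf + w + (\<Sum>s\<in>UNIV. v s) = 0"
  shows "kkt_point f \<Phi> g h x"
proof -
  obtain a b where ab: "a \<in> (\<Sum>i\<in>UNIV. (\<lambda>w. m $ Inl i *\<^sub>R w) ` limiting_subdiff (\<lambda>y. ereal (g y $ i)) x)"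
    "b \<in> (\<Sum>j\<in>UNIV. limiting_subdiff (\<lambda>y. ereal (m $ Inr j * h y $ j)) x)" "(\<Sum>s\<in>UNIV. v s) = a + b"
    using constraint_subgradients_sum[OF assms(1) lip _ v] m by blast
  then have "vf + w + a + b = 0" using assms by (simp add: add.assoc)
  then show ?thesis
    unfolding kkt_point_def using ab assms m
    by (intro exI[of _ "\<chi> i. m $ Inl i"] exI[of _ "\<chi> j. m $ Inr j"] conjI)
      (auto intro!: set_plus_intro simp flip: \<open>vf + w + a + b = 0\<close>)
qed

section \<open>Quasi-normality\<close>

lemma kkt_point_if_quasi_normality:
  fixes f :: "real^'d \<Rightarrow> real" and g :: "real^'d \<Rightarrow> real^'n" and h :: "real^'d \<Rightarrow> real^'m"
  assumes ninf: "\<And>x. \<Phi> x \<noteq> - \<infinity>" and lsc: "lower_semicontinuous \<Phi>" and fin: "\<bar>\<Phi> c\<bar> \<noteq> \<infinity>"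
    and loc: "local_minimizer (\<lambda>x. ereal (f x) + \<Phi> x) (feasible_set g h) c"
    and lip: "lipschitz_around f c" "lipschitz_around g c" "lipschitz_around h c"
    and qn: "horizon_quasi_normality \<Phi> g h c"
  shows "kkt_point f \<Phi> g h c"
proof -
  \<comment> \<open>Moving a multiplier estimate from a copy to \<open>X\<close> costs at most n L
    \<epsilon> n with n the weight; the inverse square turns this into at most L/(n+1), which tends
    to 0.\<close>
  define \<epsilon> where "\<epsilon> k = inverse ((real (Suc k))\<^sup>2)" for k
  have \<epsilon>: "\<epsilon> k > 0" for k by (simp add: \<epsilon>_def)
  obtain \<delta> Lf L r X Y U W VF V M where \<delta>: "\<delta> > 0" and lipf: "Lf-lipschitz_on (cball c \<delta>) f"
    and lipq: "\<And>s. L-lipschitz_on (cball c \<delta>) (constraint g h s)"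
    and r: "strict_mono (r :: nat \<Rightarrow> nat)" and X: "X \<longlonglongrightarrow> c" "(\<lambda>k. \<Phi> (X k)) \<longlonglongrightarrow> \<Phi> c"
    and Y: "Y \<longlonglongrightarrow> c" and U: "\<And>s. (\<lambda>k. U k $ s) \<longlonglongrightarrow> c"
    and dist: "\<And>k s. dist (U k $ s) (X k) \<le> \<epsilon> (r k)"
    and M: "\<And>k s. M k $ s = real (r k) * residual s (constraint g h s (U k $ s))"
    and subs: "\<forall>\<^sub>F k in sequentially. W k \<in> regular_subdiff \<Phi> (X k)"
    "\<forall>\<^sub>F k in sequentially. VF k \<in> regular_subdiff (\<lambda>y. ereal (f y)) (Y k)"
    "\<forall>\<^sub>F k in sequentially. \<forall>s. V k $ s \<in> regular_subdiff (\<lambda>y. ereal (M k $ s * constraint g h s y)) (U k $ s)"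
    "(\<lambda>k. W k + VF k + (\<Sum>s\<in>UNIV. V k $ s)) \<longlonglongrightarrow> 0"
    by (rule approximate_kkt_sequence[where \<epsilon> = \<epsilon>, OF ninf lsc fin loc lip \<epsilon>]) (rule that; (assumption | blast))
  obtain \<rho> t m v w where \<rho>: "strict_mono \<rho>" and t: "\<And>k. t k \<ge> (0::real)" "\<And>k. t k \<le> 1"
    and m: "(\<lambda>k. t k *\<^sub>R M (\<rho> k)) \<longlonglongrightarrow> m"
    and v: "\<And>s. v s \<in> limiting_subdiff (\<lambda>y. ereal (m $ s * constraint g h s y)) c"
    and alt: "(\<exists>vf\<in>limiting_subdiff (\<lambda>y. ereal (f y)) c. w \<in> limiting_subdiff \<Phi> c \<and> vf + w + (\<Sum>s\<in>UNIV. v s) = 0) \<or>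
     (m \<noteq> 0 \<and> w \<in> horizon_subdiff \<Phi> c \<and> w + (\<Sum>s\<in>UNIV. v s) = 0)"
    by (rule multiplier_dichotomy[OF fin \<delta> lipf lipq X Y U subs]) (rule that; (assumption | blast))
  have "c \<in> feasible_set g h" using loc unfolding local_minimizer_def by blast
  then have feas: "g c $ i \<le> 0" for i by (simp add: feasible_set_def)
  have comp: "m $ Inl i \<ge> 0 \<and> m $ Inl i * g c $ i = 0" for i
  proof (rule multiplier_limit_complementary[OF \<rho> t(1) m _ _ feas])
    show "\<forall>\<^sub>F k in sequentially. M k $ Inl i \<ge> 0" by (simp add: M residual_def)
    assume "g c $ i < 0"
    have "(\<lambda>k. constraint g h (Inl i) (U k $ Inl i)) \<longlonglongrightarrow> constraint g h (Inl i) c"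
      by (rule lipschitz_tendsto[OF lipq \<delta> U])
    then have "\<forall>\<^sub>F k in sequentially. constraint g h (Inl i) (U k $ Inl i) < 0"
      using \<open>g c $ i < 0\<close> by (intro order_tendstoD) (auto simp: constraint_def)
    then show "\<forall>\<^sub>F k in sequentially. M k $ Inl i = 0"
      by eventually_elim (simp add: M residual_def)
  qed
  from alt show ?thesis
  proof
    assume "\<exists>vf\<in>limiting_subdiff (\<lambda>y. ereal (f y)) c. w \<in> limiting_subdiff \<Phi> c \<and> vf + w + (\<Sum>s\<in>UNIV. v s) = 0"
    then show ?thesis using kkt_pointI[OF \<delta> lipq comp v] by blast
  next
    assume hor: "m \<noteq> 0 \<and> w \<in> horizon_subdiff \<Phi> c \<and> w + (\<Sum>s\<in>UNIV. v s) = 0"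
    obtain a b where ab: "a \<in> (\<Sum>i\<in>UNIV. (\<lambda>w. m $ Inl i *\<^sub>R w) ` limiting_subdiff (\<lambda>y. ereal (g y $ i)) c)"
      "b \<in> (\<Sum>j\<in>UNIV. limiting_subdiff (\<lambda>y. ereal (m $ Inr j * h y $ j)) c)" "(\<Sum>s\<in>UNIV. v s) = a + b"
      using constraint_subgradients_sum[OF \<delta> lipq _ v] comp by blast
    with hor have "w + a + b = 0" by (simp add: add.assoc)
    have viol: "\<forall>\<^sub>F k in sequentially. m $ s * residual s (constraint g h s (X (\<rho> k))) > 0" if "m $ s \<noteq> 0" for s
    proof -
      \<comment> \<open>The multiplier estimate evaluated at the common point \<open>X\<close> in
        place of the copy. Since t <= 1, its scaled limit is again m $ s.\<close>
      define R where "R k = real (r (\<rho> k)) * residual s (constraint g h s (X (\<rho> k)))" for k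
      have XY: "\<forall>\<^sub>F k in sequentially. X k \<in> cball c \<delta> \<and> U k $ s \<in> cball c \<delta>"
      proof -
        have "\<forall>\<^sub>F k in sequentially. X k \<in> ball c \<delta>" "\<forall>\<^sub>F k in sequentially. U k $ s \<in> ball c \<delta>"
          by (rule topological_tendstoD[OF X(1)] topological_tendstoD[OF U]; use \<delta> in simp)+
        then show ?thesis by eventually_elim auto
      qed
      have "\<forall>\<^sub>F k in sequentially. norm (t k * (M (\<rho> k) $ s - R k)) \<le> L * inverse (real (Suc k))"
        using eventually_subseq[OF \<rho> XY]
      proof eventually_elim
        case (elim k)
        define n where "n = r (\<rho> k)"
        have "n \<ge> k" unfolding n_def using seq_suble[OF r, of "\<rho> k"] seq_suble[OF \<rho>, of k] by simp
        have L: "L \<ge> 0" using lipq lipschitz_on_nonneg by blast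
        have "\<bar>M (\<rho> k) $ s - R k\<bar> \<le> real n * \<bar>constraint g h s (U (\<rho> k) $ s) - constraint g h s (X (\<rho> k))\<bar>"
          unfolding M R_def n_def[symmetric] right_diff_distrib[symmetric] abs_mult
          by (simp add: mult_left_mono residual_lipschitz)
        also have "\<dots> \<le> real n * (L * \<epsilon> n)"
        proof (rule mult_left_mono)
          have "\<bar>constraint g h s (U (\<rho> k) $ s) - constraint g h s (X (\<rho> k))\<bar> \<le> L * dist (U (\<rho> k) $ s) (X (\<rho> k))"
            using lipschitz_onD[OF lipq, of "U (\<rho> k) $ s" "X (\<rho> k)" s] elim by (simp add: dist_real_def)
          also have "\<dots> \<le> L * \<epsilon> n" using dist L unfolding n_def by (intro mult_left_mono)
          finally show "\<bar>constraint g h s (U (\<rho> k) $ s) - constraint g h s (X (\<rho> k))\<bar> \<le> L * \<epsilon> n" .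
        qed simp
        also have "\<dots> \<le> real (Suc n) * (L * \<epsilon> n)" using L \<epsilon>[of n] by (intro mult_right_mono) auto
        also have "\<dots> = L * inverse (real (Suc n))"
          unfolding \<epsilon>_def by (simp add: power2_eq_square divide_simps)
        also have "\<dots> \<le> L * inverse (real (Suc k))" using \<open>n \<ge> k\<close> L by (intro mult_left_mono le_imp_inverse_le) auto
        finally have "\<bar>M (\<rho> k) $ s - R k\<bar> \<le> L * inverse (real (Suc k))" .
        moreover have "\<bar>t k * (M (\<rho> k) $ s - R k)\<bar> \<le> 1 * \<bar>M (\<rho> k) $ s - R k\<bar>"
          unfolding abs_mult using t[of k] by (intro mult_right_mono) auto
        ultimately show ?case by simp
      qed
      moreover have "(\<lambda>k. L * inverse (real (Suc k))) \<longlonglongrightarrow> 0"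
        using tendsto_mult[OF tendsto_const LIMSEQ_inverse_real_of_nat, of L] by simp
      ultimately have "(\<lambda>k. t k * (M (\<rho> k) $ s - R k)) \<longlonglongrightarrow> 0" by (rule Lim_null_comparison)
      from tendsto_diff[OF tendsto_vec_nth[OF m, of s] this] have "(\<lambda>k. t k * R k) \<longlonglongrightarrow> m $ s"
        by (simp add: algebra_simps)
      \<comment> \<open>Multiplying by m $ s treats both signs at once: the limit is (m $ s)^2 > 0.
        The nonnegative factor t k * r then drops out of the sign.\<close>
      from tendsto_mult[OF tendsto_const this, of "m $ s"]
      have "\<forall>\<^sub>F k in sequentially. m $ s * (t k * R k) > 0"
        by (rule order_tendstoD(1)) (use that in \<open>auto simp: zero_less_mult_iff\<close>)
      then show ?thesis
      proof eventually_elim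
        case (elim k)
        have "m $ s * (t k * R k) = (t k * real (r (\<rho> k))) * (m $ s * residual s (constraint g h s (X (\<rho> k))))"
          by (simp add: R_def)
        moreover have "t k * real (r (\<rho> k)) \<ge> 0" using t by simp
        ultimately show ?case using elim by (metis not_less mult_nonneg_nonpos)
      qed
    qed
    have "\<forall>\<^sub>F k in sequentially. \<forall>s. m $ s \<noteq> 0 \<longrightarrow> m $ s * residual s (constraint g h s (X (\<rho> k))) > 0"
      by (rule eventually_all_finite) (use viol in \<open>auto elim: eventually_mono\<close>)
    then obtain N where N: "\<And>k s. k \<ge> N \<Longrightarrow> m $ s \<noteq> 0 \<Longrightarrow> m $ s * residual s (constraint g h s (X (\<rho> k))) > 0"
      unfolding eventually_sequentially by blast
    \<comment> \<open>Quasi-normality demands the violations for every k, so the initial segment is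
      cut off.\<close>
    define X' where "X' k = X (\<rho> (k + N))" for k
    have "X' \<longlonglongrightarrow> c"
      using LIMSEQ_ignore_initial_segment[OF LIMSEQ_subseq_LIMSEQ[OF X(1) \<rho>], of N]
      by (simp add: X'_def[abs_def] o_def)
    moreover have "m $ Inl i > 0 \<Longrightarrow> g (X' k) $ i > 0" for i k
      using N[of "k + N" "Inl i"] by (auto simp: X'_def residual_def constraint_def zero_less_mult_iff max_def split: if_splits)
    moreover have "m $ Inr j \<noteq> 0 \<Longrightarrow> m $ Inr j * h (X' k) $ j > 0" for j k
      using N[of "k + N" "Inr j"] by (simp add: X'_def residual_def constraint_def)
    moreover have "((\<chi> i. m $ Inl i) :: real^'n, (\<chi> j. m $ Inr j) :: real^'m) \<noteq> 0"
    proof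
      assume "((\<chi> i. m $ Inl i) :: real^'n, (\<chi> j. m $ Inr j) :: real^'m) = 0"
      then have "m $ Inl i = 0" "m $ Inr j = 0" for i j by (simp_all add: zero_prod_def vec_eq_iff)
      then have "m $ s = 0" for s by (cases s) auto
      then show False using hor by (simp add: vec_eq_iff)
    qed
    moreover have "0 \<in> horizon_subdiff \<Phi> c
          + (\<Sum>i\<in>UNIV. (\<lambda>w. m $ Inl i *\<^sub>R w) ` limiting_subdiff (\<lambda>y. ereal (g y $ i)) c)
          + (\<Sum>j\<in>UNIV. limiting_subdiff (\<lambda>y. ereal (m $ Inr j * h y $ j)) c)"
      using set_plus_intro[OF set_plus_intro[OF _ ab(1)] ab(2), of w] hor \<open>w + a + b = 0\<close> by simp
    ultimately have "\<not> horizon_quasi_normality \<Phi> g h c"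
      unfolding horizon_quasi_normality_def using comp
      by (simp only: not_not) (intro exI[of _ "\<chi> i. m $ Inl i"] exI[of _ "\<chi> j. m $ Inr j"], auto)
    with qn show ?thesis by blast
  qed
qed

section \<open>RCPLD\<close>

lemma smooth_around_gradient:
  fixes G :: "real^'d \<Rightarrow> real^'n"
  assumes "smooth_around G x"
  obtains \<delta> where "\<delta> > 0" "\<And>i. continuous_on (ball x \<delta>) (grad_comp G i)"
    "\<And>i y. y \<in> ball x \<delta> \<Longrightarrow> ((\<lambda>z. G z $ i) has_derivative (\<lambda>z. z \<bullet> grad_comp G i y)) (at y)"
proof -
  obtain \<delta> and f' :: "real^'d \<Rightarrow> ((real^'d) \<Rightarrow>\<^sub>L (real^'n))" where \<delta>: "\<delta> > 0"
    and der: "\<And>y. y \<in> ball x \<delta> \<Longrightarrow> (G has_derivative blinfun_apply (f' y)) (at y)"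
    and cont: "continuous_on (ball x \<delta>) f'"
    using assms unfolding smooth_around_def by blast
  \<comment> \<open>The Riesz representative of the derivative, written in coordinates so that its
    continuity in y follows from that of f' summand by summand.\<close>
  define D where "D i y = (\<Sum>b\<in>Basis. (f' y b $ i) *\<^sub>R b)" for i y
  have "f' y z $ i = z \<bullet> D i y" for y z i
  proof -
    have "f' y z $ i = f' y (\<Sum>b\<in>Basis. (z \<bullet> b) *\<^sub>R b) $ i" by (simp add: euclidean_representation)
    also have "\<dots> = (\<Sum>b\<in>Basis. (z \<bullet> b) * (f' y b $ i))"
      by (simp add: blinfun.sum_right blinfun.scaleR_right)
    also have "\<dots> = z \<bullet> D i y" by (simp add: D_def inner_sum_right mult.commute)
    finally show ?thesis .
  qed
  moreover have "((\<lambda>z. G z $ i) has_derivative (\<lambda>z. f' y z $ i)) (at y)" if "y \<in> ball x \<delta>" for i y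
    by (rule bounded_linear.has_derivative[OF bounded_linear_vec_nth der[OF that]])
  ultimately have derD: "((\<lambda>z. G z $ i) has_derivative (\<lambda>z. z \<bullet> D i y)) (at y)" if "y \<in> ball x \<delta>" for i y
    using that by simp
  have eq: "grad_comp G i y = D i y" if "y \<in> ball x \<delta>" for i y
    unfolding gradient_def
  proof (rule the_equality)
    show gd: "GDERIV (\<lambda>z. G z $ i) y :> D i y" using derD[OF that] by (simp add: gderiv_def)
    show "D' = D i y" if "GDERIV (\<lambda>z. G z $ i) y :> D'" for D'
    proof -
      have "(\<lambda>z. z \<bullet> D') = (\<lambda>z. z \<bullet> D i y)"
        using that gd unfolding gderiv_def by (rule has_derivative_unique)
      then have "z \<bullet> D' = z \<bullet> D i y" for z by metis
      then show ?thesis using vector_eq_ldot by blast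
    qed
  qed
  show thesis
  proof (rule that[OF \<delta>])
    have "continuous_on (ball x \<delta>) (D i)" for i
      unfolding D_def by (intro continuous_intros cont)
    then show "continuous_on (ball x \<delta>) (grad_comp G i)" for i
      by (rule continuous_on_eq) (use eq in simp)
  qed (use derD eq in simp)
qed

section \<open>Dependent families, conic reduction and constant rank\<close>

lemma lin_dep_family_mono:
  assumes "lin_dep_family S F" and "S \<subseteq> T" and "finite T"
  shows "lin_dep_family T F"
proof -
  obtain c where c: "\<exists>s\<in>S. c s \<noteq> 0" "(\<Sum>s\<in>S. c s *\<^sub>R F s) = 0"
    using assms(1) unfolding lin_dep_family_def by blast
  have "(\<Sum>s\<in>T. (if s \<in> S then c s else 0) *\<^sub>R F s) = (\<Sum>s\<in>S. (if s \<in> S then c s else 0) *\<^sub>R F s)"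
    by (rule sum.mono_neutral_right) (use assms in auto)
  also have "\<dots> = 0" using c(2) by simp
  finally show ?thesis unfolding lin_dep_family_def using c(1) assms(2)
    by (intro exI[of _ "\<lambda>s. if s \<in> S then c s else 0"]) auto
qed

lemma not_lin_dep_familyD:
  assumes indep: "\<not> lin_dep_family S F" and "finite S"
  shows "inj_on F S" and "independent (F ` S)"
proof -
  show inj: "inj_on F S"
  proof (rule inj_onI, rule ccontr)
    fix a b assume ab: "a \<in> S" "b \<in> S" "F a = F b" "a \<noteq> b"
    have "(\<Sum>s\<in>S. (of_bool (s = a) - of_bool (s = b)) *\<^sub>R F s) = (\<Sum>s\<in>S. if s = a then F s else 0) - (\<Sum>s\<in>S. if s = b then F s else 0)"
      by (auto simp: sum_subtractf[symmetric] intro!: sum.cong)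
    also have "\<dots> = 0" using ab \<open>finite S\<close> by simp
    finally have "lin_dep_family S F" unfolding lin_dep_family_def using ab
      by (intro exI[of _ "\<lambda>s. of_bool (s = a) - of_bool (s = b)"]) auto
    with indep show False by blast
  qed
  show "independent (F ` S)"
  proof
    assume "dependent (F ` S)"
    then obtain u where u: "\<exists>v\<in>F ` S. u v \<noteq> 0" "(\<Sum>v\<in>F ` S. u v *\<^sub>R v) = 0"
      using \<open>finite S\<close> by (auto simp: dependent_finite)
    then have "(\<Sum>s\<in>S. u (F s) *\<^sub>R F s) = 0" using inj by (simp add: sum.reindex)
    with u(1) have "lin_dep_family S F" unfolding lin_dep_family_def
      by (intro exI[of _ "\<lambda>s. u (F s)"]) auto
    with indep show False by blast
  qed
qed

lemma span_family_coefficients: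
  assumes "finite S" and "inj_on F S" and "v \<in> span (F ` S)"
  obtains c where "v = (\<Sum>s\<in>S. c s *\<^sub>R F s)"
proof -
  obtain u where "v = (\<Sum>x\<in>F ` S. u x *\<^sub>R x)" using assms by (auto simp: span_finite)
  then have "v = (\<Sum>s\<in>S. u (F s) *\<^sub>R F s)" using assms(2) by (simp add: sum.reindex)
  then show thesis by (rule that)
qed

text \<open>Otherwise infinitely many members admit a relation with coefficient vector of norm 1. A
  cluster point of these vectors is a relation for the limit family, nontrivial because the norm
  stays 1; extending by 0 outside J ensures that a nonzero coefficient lies in J.\<close>

lemma eventually_not_lin_dep_family:
  fixes F :: "'j::finite \<Rightarrow> 'a::real_normed_vector" and Fk :: "nat \<Rightarrow> 'j \<Rightarrow> 'a"
  assumes lim: "\<And>j. j \<in> J \<Longrightarrow> (\<lambda>k. Fk k j) \<longlonglongrightarrow> F j" and indep: "\<not> lin_dep_family J F"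
  shows "\<forall>\<^sub>F k in sequentially. \<not> lin_dep_family J (Fk k)"
proof (rule ccontr)
  assume "\<not> ?thesis"
  then have "infinite {k. lin_dep_family J (Fk k)}"
    by (simp add: not_eventually frequently_cofinite[symmetric] cofinite_eq_sequentially)
  then obtain r :: "nat \<Rightarrow> nat" where r: "strict_mono r" and dep: "\<And>k. lin_dep_family J (Fk (r k))"
    using infinite_enumerate by blast
  have "\<exists>c :: real^'j. norm c = 1 \<and> (\<Sum>j\<in>J. c $ j *\<^sub>R Fk (r k) j) = 0 \<and> (\<forall>j. j \<notin> J \<longrightarrow> c $ j = 0)" for k
  proof -
    obtain c where c: "\<exists>j\<in>J. c j \<noteq> 0" "(\<Sum>j\<in>J. c j *\<^sub>R Fk (r k) j) = 0"
      using dep[of k] unfolding lin_dep_family_def by blast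
    define c' :: "real^'j" where "c' = (\<chi> j. if j \<in> J then c j else 0)"
    have "c' \<noteq> 0" using c(1) by (auto simp: c'_def vec_eq_iff)
    moreover have "(\<Sum>j\<in>J. (inverse (norm c') *\<^sub>R c') $ j *\<^sub>R Fk (r k) j) = inverse (norm c') *\<^sub>R (\<Sum>j\<in>J. c j *\<^sub>R Fk (r k) j)"
      by (simp add: scaleR_sum_right c'_def)
    ultimately show ?thesis using c(2)
      by (intro exI[of _ "inverse (norm c') *\<^sub>R c'"]) (auto simp: c'_def)
  qed
  then obtain C :: "nat \<Rightarrow> real^'j" where C: "\<And>k. norm (C k) = 1"
    "\<And>k. (\<Sum>j\<in>J. C k $ j *\<^sub>R Fk (r k) j) = 0" "\<And>k j. j \<notin> J \<Longrightarrow> C k $ j = 0" by metis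
  have "\<forall>k. C k \<in> cball 0 1" using C(1) by simp
  then obtain c r' where r': "strict_mono r'" "(C \<circ> r') \<longlonglongrightarrow> c"
    using compact_cball[of "0 :: real^'j" 1] unfolding compact_def by metis
  have limC: "(\<lambda>k. C (r' k)) \<longlonglongrightarrow> c" using r'(2) by (simp add: o_def)
  have "(\<lambda>k. norm (C (r' k))) \<longlonglongrightarrow> norm c" using limC by (rule tendsto_norm)
  then have "norm c = 1" using C(1) by (simp add: LIMSEQ_const_iff)
  have "c $ j = 0" if "j \<notin> J" for j
    using tendsto_vec_nth[OF limC, of j] C(3)[OF that] by (simp add: LIMSEQ_const_iff)
  moreover have "c \<noteq> 0" using \<open>norm c = 1\<close> by auto
  ultimately have "\<exists>j\<in>J. c $ j \<noteq> 0" by (metis vec_eq_iff zero_index)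
  moreover have "(\<lambda>k. \<Sum>j\<in>J. C (r' k) $ j *\<^sub>R Fk (r (r' k)) j) \<longlonglongrightarrow> (\<Sum>j\<in>J. c $ j *\<^sub>R F j)"
  proof (intro tendsto_sum tendsto_scaleR tendsto_vec_nth limC)
    fix j assume "j \<in> J"
    then show "(\<lambda>k. Fk (r (r' k)) j) \<longlonglongrightarrow> F j"
      using LIMSEQ_subseq_LIMSEQ[OF lim strict_mono_o[OF r r'(1)], of j] by (simp add: o_def)
  qed
  then have "(\<Sum>j\<in>J. c $ j *\<^sub>R F j) = 0" using C(2) by (simp add: LIMSEQ_const_iff)
  ultimately have "lin_dep_family J F" unfolding lin_dep_family_def by blast
  with indep show False by blast
qed

text \<open>As long as the supporting family is dependent, subtract a multiple of a relation until
  one inequality coefficient becomes 0. The coefficients of H are free in sign and merely adjust;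
  independence of H guarantees that every relation involves some G, so the number of positive
  coefficients drops.\<close>

lemma conic_caratheodory:
  fixes lam :: "'i::finite \<Rightarrow> real" and G :: "'i \<Rightarrow> 'a::real_vector" and H :: "'j \<Rightarrow> 'a"
  assumes "finite J" and indep: "\<not> lin_dep_family J H" and "\<forall>i. lam i \<ge> 0"
  shows "\<exists>lam' mu'. (\<forall>i. lam' i \<ge> 0) \<and> (\<forall>i. lam' i \<noteq> 0 \<longrightarrow> lam i \<noteq> 0) \<and>
    (\<Sum>i\<in>UNIV. lam' i *\<^sub>R G i) + (\<Sum>j\<in>J. mu' j *\<^sub>R H j) = (\<Sum>i\<in>UNIV. lam i *\<^sub>R G i) + (\<Sum>j\<in>J. mu j *\<^sub>R H j) \<and>
    \<not> lin_dep_family ({i. lam' i > 0} <+> J) (case_sum G H)"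
  using assms(3)
proof (induction "card {i. lam i > 0}" arbitrary: lam mu rule: less_induct)
  case less
  define P where "P = {i. lam i > 0}"
  have outP: "lam i = 0" if "i \<notin> P" for i using that less.prems by (simp add: P_def not_less antisym)
  show ?case
  proof (cases "lin_dep_family (P <+> J) (case_sum G H)")
    case False
    then show ?thesis using less.prems unfolding P_def by (intro exI[of _ lam] exI[of _ mu]) auto
  next
    case True
    then obtain c where c: "\<exists>s\<in>P <+> J. c s \<noteq> 0" "(\<Sum>s\<in>P <+> J. c s *\<^sub>R case_sum G H s) = 0"
      unfolding lin_dep_family_def by blast
    from c(2) have c0: "(\<Sum>i\<in>P. c (Inl i) *\<^sub>R G i) + (\<Sum>j\<in>J. c (Inr j) *\<^sub>R H j) = 0"
      using \<open>finite J\<close> by (simp add: sum.Plus)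
    have "\<exists>i\<in>P. c (Inl i) \<noteq> 0"
    proof (rule ccontr)
      assume no: "\<not> ?thesis"
      with c0 have "(\<Sum>j\<in>J. c (Inr j) *\<^sub>R H j) = 0" by simp
      moreover have "\<exists>j\<in>J. c (Inr j) \<noteq> 0" using c(1) no by auto
      ultimately have "lin_dep_family J H" unfolding lin_dep_family_def by (intro exI[of _ "\<lambda>j. c (Inr j)"]) auto
      with indep show False by blast
    qed
    then obtain i1 where i1: "i1 \<in> P" "c (Inl i1) \<noteq> 0" by blast
    \<comment> \<open>The relation is multiplied by a sign so that at least one coefficient in P is
      positive, which the ratio test below requires.\<close>
    define a where "a i = sgn (c (Inl i1)) * c (Inl i)" for i
    define b where "b j = sgn (c (Inl i1)) * c (Inr j)" for j
    have "(\<Sum>i\<in>P. a i *\<^sub>R G i) + (\<Sum>j\<in>J. b j *\<^sub>R H j) =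
        sgn (c (Inl i1)) *\<^sub>R ((\<Sum>i\<in>P. c (Inl i) *\<^sub>R G i) + (\<Sum>j\<in>J. c (Inr j) *\<^sub>R H j))"
      by (simp add: a_def b_def scaleR_add_right scaleR_sum_right)
    then have ab0: "(\<Sum>i\<in>P. a i *\<^sub>R G i) + (\<Sum>j\<in>J. b j *\<^sub>R H j) = 0" using c0 by simp
    have "a i1 > 0" using i1(2) by (simp add: a_def sgn_if)
    define Q where "Q = {i \<in> P. a i > 0}"
    have "i1 \<in> Q" using i1 \<open>a i1 > 0\<close> by (simp add: Q_def)
    \<comment> \<open>Ratio test: the smallest quotient is the largest step that keeps all
      coefficients nonnegative, and it annihilates the one at i0.\<close>
    then obtain i0 where i0: "i0 \<in> Q" "\<And>i. i \<in> Q \<Longrightarrow> lam i0 / a i0 \<le> lam i / a i"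
      using ex_min_if_finite[of "(\<lambda>i. lam i / a i) ` Q"] by (fastforce simp: not_less)
    define t where "t = lam i0 / a i0"
    have "t \<ge> 0" using i0(1) less.prems by (simp add: t_def Q_def)
    define lam' where "lam' i = (if i \<in> P then lam i - t * a i else 0)" for i
    have pos: "lam' i \<ge> 0" for i
    proof (cases "i \<in> Q")
      case True
      with i0(2)[OF True] show ?thesis by (simp add: lam'_def Q_def t_def[symmetric] pos_le_divide_eq)
    next
      case False
      then show ?thesis using less.prems \<open>t \<ge> 0\<close> mult_nonneg_nonpos[of t "a i"]
        by (auto simp: lam'_def Q_def not_less intro: order_trans)
    qed
    have supp: "{i. lam' i > 0} \<subseteq> P - {i0}"
      using i0(1) by (auto simp: lam'_def t_def Q_def split: if_splits)
    have "card {i. lam' i > 0} < card {i. lam i > 0}"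
      using supp i0(1) unfolding P_def[symmetric] by (intro psubset_card_mono) (auto simp: Q_def)
    from less.hyps[OF this, of "\<lambda>j. mu j - t * b j"] pos
    obtain lam'' mu'' where *: "\<forall>i. lam'' i \<ge> 0" "\<forall>i. lam'' i \<noteq> 0 \<longrightarrow> lam' i \<noteq> 0"
      "(\<Sum>i\<in>UNIV. lam'' i *\<^sub>R G i) + (\<Sum>j\<in>J. mu'' j *\<^sub>R H j) = (\<Sum>i\<in>UNIV. lam' i *\<^sub>R G i) + (\<Sum>j\<in>J. (mu j - t * b j) *\<^sub>R H j)"
      "\<not> lin_dep_family ({i. lam'' i > 0} <+> J) (case_sum G H)"
      by blast
    have "(\<Sum>i\<in>UNIV. lam' i *\<^sub>R G i) = (\<Sum>i\<in>P. lam' i *\<^sub>R G i)"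
      by (rule sum.mono_neutral_right) (auto simp: lam'_def)
    also have "\<dots> = (\<Sum>i\<in>P. lam i *\<^sub>R G i) - t *\<^sub>R (\<Sum>i\<in>P. a i *\<^sub>R G i)"
      by (simp add: lam'_def scaleR_diff_left sum_subtractf scaleR_sum_right)
    also have "(\<Sum>i\<in>P. lam i *\<^sub>R G i) = (\<Sum>i\<in>UNIV. lam i *\<^sub>R G i)"
      by (rule sum.mono_neutral_left) (auto simp: outP)
    finally have "(\<Sum>i\<in>UNIV. lam' i *\<^sub>R G i) + (\<Sum>j\<in>J. (mu j - t * b j) *\<^sub>R H j) =
        (\<Sum>i\<in>UNIV. lam i *\<^sub>R G i) + (\<Sum>j\<in>J. mu j *\<^sub>R H j) - t *\<^sub>R ((\<Sum>i\<in>P. a i *\<^sub>R G i) + (\<Sum>j\<in>J. b j *\<^sub>R H j))"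
      by (simp add: scaleR_diff_left sum_subtractf scaleR_sum_right scaleR_add_right)
    then have "(\<Sum>i\<in>UNIV. lam' i *\<^sub>R G i) + (\<Sum>j\<in>J. (mu j - t * b j) *\<^sub>R H j) =
        (\<Sum>i\<in>UNIV. lam i *\<^sub>R G i) + (\<Sum>j\<in>J. mu j *\<^sub>R H j)" using ab0 by simp
    moreover have "lam i \<noteq> 0" if "lam' i \<noteq> 0" for i
      using that by (auto simp: lam'_def P_def split: if_splits)
    ultimately show ?thesis using * by (intro exI[of _ lam''] exI[of _ mu'']) auto
  qed
qed

text \<open>A dimension count: independence gives both J-families rank card J, at the reference
  point this is the rank of all vectors, and constancy of that rank carries it over.\<close>

lemma constant_rank_span:
  fixes H :: "'j::finite \<Rightarrow> real^'d" and H0 :: "'j \<Rightarrow> real^'d"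
  assumes "\<not> lin_dep_family J H" and "\<not> lin_dep_family J H0"
    and "span (H0 ` J) = span (range H0)" and "dim (range H) = dim (range H0)"
  shows "H j \<in> span (H ` J)"
proof -
  have "dim (range H0) = card J"
    using not_lin_dep_familyD[OF assms(2)] assms(3) by (metis card_image dim_eq_card finite)
  moreover have "dim (H ` J) = card J"
    using not_lin_dep_familyD[OF assms(1)] by (metis card_image dim_eq_card_independent finite)
  ultimately have "span (H ` J) = span (range H)"
    using assms(4) by (intro dim_eq_span) auto
  then show ?thesis using span_base[of "H j" "range H"] by simp
qed

lemma limiting_subdiff_gradient:
  fixes q :: "real^'d \<Rightarrow> real"
  assumes der: "\<And>y. y \<in> ball x \<delta> \<Longrightarrow> (q has_derivative (\<lambda>z. z \<bullet> D y)) (at y)"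
    and cont: "continuous_on (ball x \<delta>) D" and "\<delta> > 0"
    and v: "v \<in> limiting_subdiff (\<lambda>y. ereal (a * q y)) x"
  shows "v = a *\<^sub>R D x"
proof -
  obtain X V where X: "X \<longlonglongrightarrow> x" and V: "\<And>k. V k \<in> regular_subdiff (\<lambda>y. ereal (a * q y)) (X k)" "V \<longlonglongrightarrow> v"
    using v unfolding limiting_subdiff_def by blast
  have "\<forall>\<^sub>F k in sequentially. X k \<in> ball x \<delta>"
    using X \<open>\<delta> > 0\<close> by (intro topological_tendstoD) auto
  then have "\<forall>\<^sub>F k in sequentially. a *\<^sub>R D (X k) = V k"
  proof eventually_elim
    case (elim k)
    show ?case using V(1)[of k] regular_subdiff_gradient[OF der[OF elim], of "V k" a] by simp
  qed
  moreover have "isCont D x" using cont \<open>\<delta> > 0\<close> by (simp add: continuous_on_eq_continuous_at)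
  then have "(\<lambda>k. D (X k)) \<longlonglongrightarrow> D x" using X by (rule isCont_tendsto_compose)
  then have "(\<lambda>k. a *\<^sub>R D (X k)) \<longlonglongrightarrow> a *\<^sub>R D x" by (rule tendsto_scaleR[OF tendsto_const])
  ultimately have "V \<longlonglongrightarrow> a *\<^sub>R D x" by (rule Lim_transform_eventually[rotated])
  with V(2) show ?thesis by (rule LIMSEQ_unique)
qed

text \<open>Equality gradients are rewritten in terms of the basis \<open>J\<close>, then superfluous inequality
  gradients are removed.\<close>

lemma reduced_multipliers:
  fixes D :: "'n::finite + 'm::finite \<Rightarrow> real^'d" and m :: "real^('n + 'm)"
  assumes indep: "\<not> lin_dep_family J (\<lambda>j. D (Inr j))" and span: "\<And>j. D (Inr j) \<in> span ((\<lambda>j. D (Inr j)) ` J)"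
    and nonneg: "\<forall>i. m $ Inl i \<ge> 0"
  shows "\<exists>m'. (\<forall>i. m' $ Inl i \<ge> 0) \<and> (\<forall>i. m' $ Inl i \<noteq> 0 \<longrightarrow> m $ Inl i \<noteq> 0) \<and> (\<forall>j. j \<notin> J \<longrightarrow> m' $ Inr j = 0) \<and>
    (\<Sum>s\<in>UNIV. m' $ s *\<^sub>R D s) = (\<Sum>s\<in>UNIV. m $ s *\<^sub>R D s) \<and>
    \<not> lin_dep_family ({i. m' $ Inl i > 0} <+> J) (case_sum (\<lambda>i. D (Inl i)) (\<lambda>j. D (Inr j)))"
proof -
  have "(\<Sum>j\<in>UNIV. m $ Inr j *\<^sub>R D (Inr j)) \<in> span ((\<lambda>j. D (Inr j)) ` J)"
    by (intro span_sum span_scale span)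
  from span_family_coefficients[OF finite not_lin_dep_familyD(1)[OF indep finite] this]
  obtain mu where mu: "(\<Sum>j\<in>UNIV. m $ Inr j *\<^sub>R D (Inr j)) = (\<Sum>j\<in>J. mu j *\<^sub>R D (Inr j))" .
  obtain lam' mu' where *: "\<forall>i. lam' i \<ge> 0" "\<forall>i. lam' i \<noteq> 0 \<longrightarrow> m $ Inl i \<noteq> 0"
    "(\<Sum>i\<in>UNIV. lam' i *\<^sub>R D (Inl i)) + (\<Sum>j\<in>J. mu' j *\<^sub>R D (Inr j)) =
     (\<Sum>i\<in>UNIV. m $ Inl i *\<^sub>R D (Inl i)) + (\<Sum>j\<in>J. mu j *\<^sub>R D (Inr j))"
    "\<not> lin_dep_family ({i. lam' i > 0} <+> J) (case_sum (\<lambda>i. D (Inl i)) (\<lambda>j. D (Inr j)))"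
    using conic_caratheodory[OF finite indep nonneg, where G = "\<lambda>i. D (Inl i)" and mu = mu] by blast
  define m' :: "real^('n + 'm)" where "m' = (\<chi> s. case s of Inl i \<Rightarrow> lam' i | Inr j \<Rightarrow> if j \<in> J then mu' j else 0)"
  have "(\<Sum>j\<in>UNIV. m' $ Inr j *\<^sub>R D (Inr j)) = (\<Sum>j\<in>J. m' $ Inr j *\<^sub>R D (Inr j))"
    by (rule sum.mono_neutral_right) (auto simp: m'_def)
  also have "\<dots> = (\<Sum>j\<in>J. mu' j *\<^sub>R D (Inr j))" by (simp add: m'_def)
  finally have "(\<Sum>s\<in>UNIV. m' $ s *\<^sub>R D s) = (\<Sum>s\<in>UNIV. m $ s *\<^sub>R D s)"
    unfolding sum_UNIV_Plus mu using *(3) by (simp add: m'_def)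
  then show ?thesis using * by (intro exI[of _ m']) (auto simp: m'_def)
qed

lemma kkt_point_if_rcpld:
  fixes f :: "real^'d \<Rightarrow> real" and g :: "real^'d \<Rightarrow> real^'n" and h :: "real^'d \<Rightarrow> real^'m"
  assumes ninf: "\<And>x. \<Phi> x \<noteq> - \<infinity>" and lsc: "lower_semicontinuous \<Phi>" and fin: "\<bar>\<Phi> c\<bar> \<noteq> \<infinity>"
    and loc: "local_minimizer (\<lambda>x. ereal (f x) + \<Phi> x) (feasible_set g h) c"
    and lip: "lipschitz_around f c" "lipschitz_around g c" "lipschitz_around h c"
    and rcpld: "horizon_rcpld \<Phi> g h c" and smooth: "smooth_around g c" "smooth_around h c"
  shows "kkt_point f \<Phi> g h c"
proof -
  define D where "D s = gradient (constraint g h s)" for s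
  have DInl: "D (Inl i) = grad_comp g i" and DInr: "D (Inr j) = grad_comp h j" for i j
    by (simp_all add: D_def constraint_def[abs_def])
  obtain \<delta>0 where \<delta>0: "\<delta>0 > 0" and contD: "\<And>s. continuous_on (ball c \<delta>0) (D s)"
    and derD: "\<And>s y. y \<in> ball c \<delta>0 \<Longrightarrow> (constraint g h s has_derivative (\<lambda>z. z \<bullet> D s y)) (at y)"
  proof -
    obtain d1 where d1: "d1 > 0" "\<And>i. continuous_on (ball c d1) (grad_comp g i)"
      "\<And>i y. y \<in> ball c d1 \<Longrightarrow> ((\<lambda>z. g z $ i) has_derivative (\<lambda>z. z \<bullet> grad_comp g i y)) (at y)"
      using smooth_around_gradient[OF smooth(1)] by blast
    obtain d2 where d2: "d2 > 0" "\<And>j. continuous_on (ball c d2) (grad_comp h j)"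
      "\<And>j y. y \<in> ball c d2 \<Longrightarrow> ((\<lambda>z. h z $ j) has_derivative (\<lambda>z. z \<bullet> grad_comp h j y)) (at y)"
      using smooth_around_gradient[OF smooth(2)] by blast
    show thesis
    proof (rule that[of "min d1 d2"])
      show "continuous_on (ball c (min d1 d2)) (D s)" for s
      proof (cases s)
        case (Inl i)
        show ?thesis unfolding Inl DInl by (rule continuous_on_subset[OF d1(2)]) auto
      next
        case (Inr j)
        show ?thesis unfolding Inr DInr by (rule continuous_on_subset[OF d2(2)]) auto
      qed
      show "(constraint g h s has_derivative (\<lambda>z. z \<bullet> D s y)) (at y)" if "y \<in> ball c (min d1 d2)" for s y
      proof (cases s)
        case (Inl i)
        have "constraint g h s = (\<lambda>z. g z $ i)" by (simp add: Inl constraint_def fun_eq_iff)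
        then show ?thesis using d1(3)[of y i] that by (simp add: Inl DInl)
      next
        case (Inr j)
        have "constraint g h s = (\<lambda>z. h z $ j)" by (simp add: Inr constraint_def fun_eq_iff)
        then show ?thesis using d2(3)[of y j] that by (simp add: Inr DInr)
      qed
    qed (use d1 d2 in auto)
  qed
  define K where "K = cball c (\<delta>0 / 2)"
  have Kball: "K \<subseteq> ball c \<delta>0" using \<delta>0 by (auto simp: K_def)
  have "\<exists>\<epsilon>>0. \<forall>y\<in>K. \<forall>z\<in>K. dist y z \<le> \<epsilon> \<longrightarrow> (\<forall>s. norm (D s y - D s z) \<le> inverse ((real (Suc k))\<^sup>2))" for k
  proof -
    \<comment> \<open>All gradients in one vector, so that a single modulus of uniform continuity
      serves every s.\<close>
    define \<Gamma> where "\<Gamma> y = (\<chi> s. D s y)" for y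
    have "continuous_on K \<Gamma>" unfolding \<Gamma>_def
      by (intro continuous_on_vec_lambda continuous_on_subset[OF contD Kball])
    then have "uniformly_continuous_on K \<Gamma>" unfolding K_def by (intro compact_uniformly_continuous) auto
    moreover have "inverse ((real (Suc k))\<^sup>2) > 0" by simp
    ultimately obtain d where d: "d > 0" "\<And>y z. y \<in> K \<Longrightarrow> z \<in> K \<Longrightarrow> dist z y < d \<Longrightarrow> dist (\<Gamma> z) (\<Gamma> y) < inverse ((real (Suc k))\<^sup>2)"
      unfolding uniformly_continuous_on_def by blast
    have "norm (D s y - D s z) \<le> inverse ((real (Suc k))\<^sup>2)" if "y \<in> K" "z \<in> K" "dist y z \<le> d / 2" for y z s
    proof -
      have "dist (\<Gamma> y) (\<Gamma> z) < inverse ((real (Suc k))\<^sup>2)" using d that by auto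
      moreover have "dist (\<Gamma> y $ s) (\<Gamma> z $ s) \<le> dist (\<Gamma> y) (\<Gamma> z)" by (rule dist_vec_nth_le)
      ultimately show ?thesis by (simp add: \<Gamma>_def dist_norm)
    qed
    then show ?thesis using d(1) by (intro exI[of _ "d / 2"]) auto
  qed
  then obtain \<epsilon> where \<epsilon>: "\<And>k. \<epsilon> k > 0" and unif: "\<And>k y z s. y \<in> K \<Longrightarrow> z \<in> K \<Longrightarrow> dist y z \<le> \<epsilon> k \<Longrightarrow>
      norm (D s y - D s z) \<le> inverse ((real (Suc k))\<^sup>2)" by metis
  obtain \<delta> Lf L r X Y U W VF V M where \<delta>: "\<delta> > 0" and lipf: "Lf-lipschitz_on (cball c \<delta>) f"
    and lipq: "\<And>s. L-lipschitz_on (cball c \<delta>) (constraint g h s)"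
    and r: "strict_mono (r :: nat \<Rightarrow> nat)" and X: "X \<longlonglongrightarrow> c" "(\<lambda>k. \<Phi> (X k)) \<longlonglongrightarrow> \<Phi> c"
    and Y: "Y \<longlonglongrightarrow> c" and U: "\<And>s. (\<lambda>k. U k $ s) \<longlonglongrightarrow> c"
    and dist: "\<And>k s. dist (U k $ s) (X k) \<le> \<epsilon> (r k)"
    and M: "\<And>k s. M k $ s = real (r k) * residual s (constraint g h s (U k $ s))"
    and W: "\<forall>\<^sub>F k in sequentially. W k \<in> regular_subdiff \<Phi> (X k)"
    and VF: "\<forall>\<^sub>F k in sequentially. VF k \<in> regular_subdiff (\<lambda>y. ereal (f y)) (Y k)"
    and V: "\<forall>\<^sub>F k in sequentially. \<forall>s. V k $ s \<in> regular_subdiff (\<lambda>y. ereal (M k $ s * constraint g h s y)) (U k $ s)"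
    and sum0: "(\<lambda>k. W k + VF k + (\<Sum>s\<in>UNIV. V k $ s)) \<longlonglongrightarrow> 0"
    by (rule approximate_kkt_sequence[where \<epsilon> = \<epsilon>, OF ninf lsc fin loc lip \<epsilon>]) (rule that; (assumption | blast))
  have "c \<in> feasible_set g h" using loc unfolding local_minimizer_def by blast
  then have feas: "g c $ i \<le> 0" and res_c: "residual s (constraint g h s c) = 0" for i s
    by (simp add: feasible_set_def, simp add: feasible_set_iff)
  have XK: "\<forall>\<^sub>F k in sequentially. X k \<in> K" 
  proof -
    have "\<forall>\<^sub>F k in sequentially. X k \<in> ball c (\<delta>0 / 2)"
      by (rule topological_tendstoD[OF X(1)]) (use \<delta>0 in auto)
    then show ?thesis by eventually_elim (simp add: K_def)
  qed
  have UK: "\<forall>\<^sub>F k in sequentially. \<forall>s. U k $ s \<in> K"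
  proof (rule eventually_all_finite)
    fix s
    have "\<forall>\<^sub>F k in sequentially. U k $ s \<in> ball c (\<delta>0 / 2)"
      by (rule topological_tendstoD[OF U]) (use \<delta>0 in auto)
    then show "\<forall>\<^sub>F k in sequentially. U k $ s \<in> K" by eventually_elim (simp add: K_def)
  qed
  have VD: "\<forall>\<^sub>F k in sequentially. \<forall>s. V k $ s = M k $ s *\<^sub>R D s (U k $ s)"
    using V UK
  proof eventually_elim
    case (elim k)
    show ?case
    proof
      fix s
      have "U k $ s \<in> ball c \<delta>0" using elim(2) Kball by blast
      from regular_subdiff_gradient[OF derD[OF this]] elim(1) show "V k $ s = M k $ s *\<^sub>R D s (U k $ s)" by blast
    qed
  qed
  \<comment> \<open>Each residual at its copy tends to the residual at c, which is 0 by feasibility;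
    once it is below 1, the multiplier is at most the weight.\<close>
  have Mr: "\<forall>\<^sub>F k in sequentially. \<forall>s. \<bar>M k $ s\<bar> \<le> real (r k)"
  proof (rule eventually_all_finite)
    fix s
    have "(\<lambda>k. constraint g h s (U k $ s) - constraint g h s c) \<longlonglongrightarrow> constraint g h s c - constraint g h s c"
      by (intro tendsto_intros lipschitz_tendsto[OF lipq \<delta> U])
    then have "(\<lambda>k. constraint g h s (U k $ s) - constraint g h s c) \<longlonglongrightarrow> 0" by simp
    then have "\<forall>\<^sub>F k in sequentially. norm (constraint g h s (U k $ s) - constraint g h s c) < 1"
      using order_tendstoD(2)[OF tendsto_norm_zero] zero_less_one by blast
    then show "\<forall>\<^sub>F k in sequentially. \<bar>M k $ s\<bar> \<le> real (r k)"
    proof eventually_elim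
      case (elim k)
      then have "\<bar>residual s (constraint g h s (U k $ s))\<bar> \<le> 1"
        using residual_lipschitz[of s "constraint g h s (U k $ s)" "constraint g h s c"] res_c[of s] by simp
      then show ?case unfolding M abs_mult by (simp add: mult_left_le)
    qed
  qed
  \<comment> \<open>Replacing the gradients at the copies by those at X costs at most (r k + 1) / (r
    k + 1)^2 per constraint, although the multipliers may be unbounded.\<close>
  have move: "(\<lambda>k. \<Sum>s\<in>UNIV. M k $ s *\<^sub>R (D s (X k) - D s (U k $ s))) \<longlonglongrightarrow> 0"
  proof (rule tendsto_null_sum)
    fix s
    have "\<forall>\<^sub>F k in sequentially. norm (M k $ s *\<^sub>R (D s (X k) - D s (U k $ s))) \<le> inverse (real (Suc k))"
      using XK UK Mr
    proof eventually_elim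
      case (elim k)
      have "norm (D s (X k) - D s (U k $ s)) \<le> inverse ((real (Suc (r k)))\<^sup>2)"
        using elim dist[of k s] by (intro unif) (auto simp: dist_commute)
      then have "\<bar>M k $ s\<bar> * norm (D s (X k) - D s (U k $ s)) \<le> real (Suc (r k)) * inverse ((real (Suc (r k)))\<^sup>2)"
        using elim(3) by (intro mult_mono) (auto intro: order_trans)
      also have "\<dots> = inverse (real (Suc (r k)))" by (simp add: power2_eq_square divide_simps)
      also have "\<dots> \<le> inverse (real (Suc k))"
        using seq_suble[OF r, of k] by (intro le_imp_inverse_le) auto
      finally show ?case by simp
    qed
    then show "(\<lambda>k. M k $ s *\<^sub>R (D s (X k) - D s (U k $ s))) \<longlonglongrightarrow> 0"
      using LIMSEQ_inverse_real_of_nat by (rule Lim_null_comparison)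
  qed
  from rcpld[unfolded horizon_rcpld_def, folded DInl DInr]
  obtain J where J: "\<not> lin_dep_family J (\<lambda>j. D (Inr j) c)"
      "span ((\<lambda>j. D (Inr j) c) ` J) = span (range (\<lambda>j. D (Inr j) c))"
    and "\<exists>\<delta>>0. (\<forall>y\<in>cball c \<delta>. dim (range (\<lambda>j. D (Inr j) y)) = dim (range (\<lambda>j. D (Inr j) c))) \<and>
      (\<forall>I. I \<subseteq> active_set g c \<longrightarrow>
        (\<exists>lam mu. (\<forall>i\<in>I. lam i \<ge> 0) \<and> ((\<exists>i\<in>I. lam i \<noteq> 0) \<or> (\<exists>j\<in>J. mu j \<noteq> 0)) \<and>
          0 \<in> horizon_subdiff \<Phi> c + {(\<Sum>i\<in>I. lam i *\<^sub>R D (Inl i) c) + (\<Sum>j\<in>J. mu j *\<^sub>R D (Inr j) c)}) \<longrightarrow>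
        (\<forall>y\<in>cball c \<delta>. lin_dep_family (I <+> J) (case_sum (\<lambda>i. D (Inl i) y) (\<lambda>j. D (Inr j) y))))"
    by - (erule exE, elim conjE, rule that)
  then obtain \<delta>r where "\<delta>r > 0"
    and rank: "\<And>y. y \<in> cball c \<delta>r \<Longrightarrow> dim (range (\<lambda>j. D (Inr j) y)) = dim (range (\<lambda>j. D (Inr j) c))"
    and rcpld_dep: "\<forall>I. I \<subseteq> active_set g c \<longrightarrow>
        (\<exists>lam mu. (\<forall>i\<in>I. lam i \<ge> 0) \<and> ((\<exists>i\<in>I. lam i \<noteq> 0) \<or> (\<exists>j\<in>J. mu j \<noteq> 0)) \<and>
          0 \<in> horizon_subdiff \<Phi> c + {(\<Sum>i\<in>I. lam i *\<^sub>R D (Inl i) c) + (\<Sum>j\<in>J. mu j *\<^sub>R D (Inr j) c)}) \<longrightarrow>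
        (\<forall>y\<in>cball c \<delta>r. lin_dep_family (I <+> J) (case_sum (\<lambda>i. D (Inl i) y) (\<lambda>j. D (Inr j) y)))"
    by - (erule exE, elim conjE, rule that, assumption, erule bspec)
  have dep: "lin_dep_family (I <+> J) (case_sum (\<lambda>i. D (Inl i) y) (\<lambda>j. D (Inr j) y))"
    if "I \<subseteq> active_set g c" "\<forall>i\<in>I. lam i \<ge> 0" "(\<exists>i\<in>I. lam i \<noteq> 0) \<or> (\<exists>j\<in>J. mu j \<noteq> 0)"
      "0 \<in> horizon_subdiff \<Phi> c + {(\<Sum>i\<in>I. lam i *\<^sub>R D (Inl i) c) + (\<Sum>j\<in>J. mu j *\<^sub>R D (Inr j) c)}"
      "y \<in> cball c \<delta>r" for I lam mu y
  proof -
    have "\<exists>lam mu. (\<forall>i\<in>I. lam i \<ge> 0) \<and> ((\<exists>i\<in>I. lam i \<noteq> 0) \<or> (\<exists>j\<in>J. mu j \<noteq> 0)) \<and>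
          0 \<in> horizon_subdiff \<Phi> c + {(\<Sum>i\<in>I. lam i *\<^sub>R D (Inl i) c) + (\<Sum>j\<in>J. mu j *\<^sub>R D (Inr j) c)}"
      using that(2-4) by (intro exI[of _ lam] exI[of _ mu] conjI)
    then show ?thesis using rcpld_dep[rule_format, OF that(1) _ that(5)] by blast
  qed
  have Xr: "\<forall>\<^sub>F k in sequentially. X k \<in> cball c \<delta>r"
  proof -
    have "\<forall>\<^sub>F k in sequentially. X k \<in> ball c \<delta>r"
      by (rule topological_tendstoD[OF X(1)]) (use \<open>\<delta>r > 0\<close> in auto)
    then show ?thesis by eventually_elim simp
  qed
  have "(\<lambda>k. D s (X k)) \<longlonglongrightarrow> D s c" for s
  proof -
    have "isCont (D s) c" using contD[of s] \<delta>0 by (simp add: continuous_on_eq_continuous_at)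
    then show ?thesis using X(1) by (rule isCont_tendsto_compose)
  qed
  then have indepJ: "\<forall>\<^sub>F k in sequentially. \<not> lin_dep_family J (\<lambda>j. D (Inr j) (X k))"
    using J(1) by (intro eventually_not_lin_dep_family) auto
  define good where "good k m' \<longleftrightarrow> (\<forall>i. m' $ Inl i \<ge> 0) \<and> (\<forall>i. m' $ Inl i \<noteq> 0 \<longrightarrow> M k $ Inl i \<noteq> 0) \<and> (\<forall>j. j \<notin> J \<longrightarrow> m' $ Inr j = 0) \<and>
    (\<Sum>s\<in>UNIV. m' $ s *\<^sub>R D s (X k)) = (\<Sum>s\<in>UNIV. M k $ s *\<^sub>R D s (X k)) \<and>
    \<not> lin_dep_family ({i. m' $ Inl i > 0} <+> J) (case_sum (\<lambda>i. D (Inl i) (X k)) (\<lambda>j. D (Inr j) (X k)))" for k m'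
  \<comment> \<open>Reduced multipliers are only known to exist for large k, so they are chosen for
    all k and specified eventually.\<close>
  define M' where "M' k = (SOME m'. good k m')" for k
  have good: "\<forall>\<^sub>F k in sequentially. good k (M' k)"
    using Xr indepJ
  proof eventually_elim
    case (elim k)
    have "D (Inr j) (X k) \<in> span ((\<lambda>j. D (Inr j) (X k)) ` J)" for j
      by (rule constant_rank_span[OF elim(2) J rank[OF elim(1)]])
    moreover have "\<forall>i. M k $ Inl i \<ge> 0" by (simp add: M residual_def)
    ultimately have "\<exists>m'. good k m'"
      unfolding good_def by (intro reduced_multipliers elim(2))
    then show ?case unfolding M'_def by (rule someI_ex)
  qed
  define V' where "V' k = (\<chi> s. M' k $ s *\<^sub>R D s (X k))" for k
  have V': "\<forall>\<^sub>F k in sequentially. \<forall>s. V' k $ s \<in> regular_subdiff (\<lambda>y. ereal (M' k $ s * constraint g h s y)) (X k)"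
    using XK
  proof eventually_elim
    case (elim k)
    then have "X k \<in> ball c \<delta>0" using Kball by blast
    then show ?case by (simp add: V'_def regular_subdiff_gradient[OF derD])
  qed
  have sum0': "(\<lambda>k. W k + VF k + (\<Sum>s\<in>UNIV. V' k $ s)) \<longlonglongrightarrow> 0"
  proof -
    have "\<forall>\<^sub>F k in sequentially. W k + VF k + (\<Sum>s\<in>UNIV. V k $ s) + (\<Sum>s\<in>UNIV. M k $ s *\<^sub>R (D s (X k) - D s (U k $ s)))
        = W k + VF k + (\<Sum>s\<in>UNIV. V' k $ s)"
      using VD good
      by eventually_elim (simp add: V'_def good_def scaleR_diff_right sum_subtractf)
    with tendsto_add[OF sum0 move] show ?thesis by (auto intro: Lim_transform_eventually)
  qed
  \<comment> \<open>All constraint subgradients now sit at X, so X also takes the place of every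
    copy. The reduced multipliers need not be bounded when the original ones are, hence the
    dichotomy for \<open>M'\<close>.\<close>
  obtain \<rho> t m v w where \<rho>: "strict_mono \<rho>" and t: "\<And>k. t k \<ge> (0::real)" "\<And>k. t k \<le> 1"
    and m: "(\<lambda>k. t k *\<^sub>R M' (\<rho> k)) \<longlonglongrightarrow> m"
    and v: "\<And>s. v s \<in> limiting_subdiff (\<lambda>y. ereal (m $ s * constraint g h s y)) c"
    and alt: "(\<exists>vf\<in>limiting_subdiff (\<lambda>y. ereal (f y)) c. w \<in> limiting_subdiff \<Phi> c \<and> vf + w + (\<Sum>s\<in>UNIV. v s) = 0) \<or>
     (m \<noteq> 0 \<and> w \<in> horizon_subdiff \<Phi> c \<and> w + (\<Sum>s\<in>UNIV. v s) = 0)"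
    by (rule multiplier_dichotomy[where U = "\<lambda>k s. X k", OF fin \<delta> lipf lipq X Y X(1) W VF V' sum0'])
      (rule that; (assumption | blast))
  have comp: "m $ Inl i \<ge> 0 \<and> m $ Inl i * g c $ i = 0" for i
  proof (rule multiplier_limit_complementary[OF \<rho> t(1) m _ _ feas])
    show "\<forall>\<^sub>F k in sequentially. M' k $ Inl i \<ge> 0"
      using good by eventually_elim (simp add: good_def)
    assume "g c $ i < 0"
    have "(\<lambda>k. constraint g h (Inl i) (U k $ Inl i)) \<longlonglongrightarrow> constraint g h (Inl i) c"
      by (rule lipschitz_tendsto[OF lipq \<delta> U])
    then have "\<forall>\<^sub>F k in sequentially. constraint g h (Inl i) (U k $ Inl i) < 0"
      using \<open>g c $ i < 0\<close> by (intro order_tendstoD) (auto simp: constraint_def)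
    with good show "\<forall>\<^sub>F k in sequentially. M' k $ Inl i = 0"
    proof eventually_elim
      case (elim k)
      then have "M k $ Inl i = 0" by (simp add: M residual_def)
      then show ?case using elim(1) by (auto simp: good_def)
    qed
  qed
  from alt show ?thesis
  proof
    assume "\<exists>vf\<in>limiting_subdiff (\<lambda>y. ereal (f y)) c. w \<in> limiting_subdiff \<Phi> c \<and> vf + w + (\<Sum>s\<in>UNIV. v s) = 0"
    then show ?thesis using kkt_pointI[OF \<delta> lipq comp v] by blast
  next
    assume hor: "m \<noteq> 0 \<and> w \<in> horizon_subdiff \<Phi> c \<and> w + (\<Sum>s\<in>UNIV. v s) = 0"
    define I where "I = {i. m $ Inl i > 0}"
    have notI: "m $ Inl i = 0" if "i \<notin> I" for i using comp[of i] that by (simp add: I_def)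
    have notJ: "m $ Inr j = 0" if "j \<notin> J" for j
    proof -
      have "\<forall>\<^sub>F k in sequentially. M' (\<rho> k) $ Inr j = 0"
        using eventually_subseq[OF \<rho> good] by eventually_elim (use that in \<open>simp add: good_def\<close>)
      then have "\<forall>\<^sub>F k in sequentially. (t k *\<^sub>R M' (\<rho> k)) $ Inr j = 0" by eventually_elim simp
      then have "(\<lambda>k. (t k *\<^sub>R M' (\<rho> k)) $ Inr j) \<longlonglongrightarrow> 0" by (rule tendsto_eventually)
      with tendsto_vec_nth[OF m] show ?thesis by (rule LIMSEQ_unique)
    qed
    have "v s = m $ s *\<^sub>R D s c" for s
      by (rule limiting_subdiff_gradient[OF derD contD \<delta>0 v])
    then have "(\<Sum>s\<in>UNIV. v s) = (\<Sum>i\<in>UNIV. m $ Inl i *\<^sub>R D (Inl i) c) + (\<Sum>j\<in>UNIV. m $ Inr j *\<^sub>R D (Inr j) c)"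
      by (simp add: sum_UNIV_Plus)
    also have "(\<Sum>i\<in>UNIV. m $ Inl i *\<^sub>R D (Inl i) c) = (\<Sum>i\<in>I. m $ Inl i *\<^sub>R D (Inl i) c)"
      by (rule sum.mono_neutral_right) (auto simp: notI)
    also have "(\<Sum>j\<in>UNIV. m $ Inr j *\<^sub>R D (Inr j) c) = (\<Sum>j\<in>J. m $ Inr j *\<^sub>R D (Inr j) c)"
      by (rule sum.mono_neutral_right) (auto simp: notJ)
    finally have zero: "w + ((\<Sum>i\<in>I. m $ Inl i *\<^sub>R D (Inl i) c) + (\<Sum>j\<in>J. m $ Inr j *\<^sub>R D (Inr j) c)) = 0"
      using hor by simp
    have "I \<subseteq> active_set g c"
    proof
      fix i assume "i \<in> I"
      then show "i \<in> active_set g c" using comp[of i] by (simp add: I_def active_set_def)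
    qed
    moreover have "\<forall>i\<in>I. m $ Inl i \<ge> 0" using comp by blast
    moreover have "(\<exists>i\<in>I. m $ Inl i \<noteq> 0) \<or> (\<exists>j\<in>J. m $ Inr j \<noteq> 0)"
    proof (rule ccontr)
      assume "\<not> ?thesis"
      then have "m $ s = 0" for s by (cases s) (use notI notJ in blast)+
      then show False using hor by (simp add: vec_eq_iff)
    qed
    moreover have "0 \<in> horizon_subdiff \<Phi> c + {(\<Sum>i\<in>I. m $ Inl i *\<^sub>R D (Inl i) c) + (\<Sum>j\<in>J. m $ Inr j *\<^sub>R D (Inr j) c)}"
      unfolding zero[symmetric] using hor by (intro set_plus_intro) auto
    \<comment> \<open>The nonzero limit multiplier is supported on active indices and J, so RCPLD
      forces dependence at every y near c, in particular at the points X.\<close>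
    ultimately have dep': "lin_dep_family (I <+> J) (case_sum (\<lambda>i. D (Inl i) y) (\<lambda>j. D (Inr j) y))" if "y \<in> cball c \<delta>r" for y
      using that by (rule dep)
    have "\<forall>\<^sub>F k in sequentially. \<forall>i. i \<in> I \<longrightarrow> M' (\<rho> k) $ Inl i > 0"
    proof (rule eventually_all_finite)
      fix i
      show "\<forall>\<^sub>F k in sequentially. i \<in> I \<longrightarrow> M' (\<rho> k) $ Inl i > 0"
      proof (cases "i \<in> I")
        case True
        then have "\<forall>\<^sub>F k in sequentially. (t k *\<^sub>R M' (\<rho> k)) $ Inl i > 0"
          by (intro order_tendstoD(1)[OF tendsto_vec_nth[OF m]]) (simp add: I_def)
        then show ?thesis
        proof eventually_elim
          case (elim k)
          then show ?case using t(1)[of k] by (simp add: zero_less_mult_iff)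
        qed
      qed simp
    qed
    \<comment> \<open>Indices in I have positive limit, so they eventually belong to the support of
      \<open>M'\<close>. There the gradients at X are independent by construction, against the
      dependence of the subfamily over I and J.\<close>
    with eventually_subseq[OF \<rho> good] eventually_subseq[OF \<rho> Xr]
    have "\<forall>\<^sub>F k in sequentially. False"
    proof eventually_elim
      case (elim k)
      have "I <+> J \<subseteq> {i. M' (\<rho> k) $ Inl i > 0} <+> J" using elim(3) by auto
      with dep'[OF elim(2)] have "lin_dep_family ({i. M' (\<rho> k) $ Inl i > 0} <+> J)
          (case_sum (\<lambda>i. D (Inl i) (X (\<rho> k))) (\<lambda>j. D (Inr j) (X (\<rho> k))))"
        by (rule lin_dep_family_mono) simp
      then show ?case using elim(1) by (simp add: good_def)
    qed
    then show ?thesis by simp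
  qed
qed

theorem theorem1:
  fixes f :: "real^'d \<Rightarrow> real"
    and g :: "real^'d \<Rightarrow> real^'n"
    and h :: "real^'d \<Rightarrow> real^'m"
    and \<Phi> :: "real^'d \<Rightarrow> ereal"
    and xstar :: "real^'d"
  assumes "\<And>x. \<Phi> x \<noteq> - \<infinity>"
    and "lower_semicontinuous \<Phi>"
    and "\<bar>\<Phi> xstar\<bar> \<noteq> \<infinity>"
    and "local_minimizer (\<lambda>x. ereal (f x) + \<Phi> x) (feasible_set g h) xstar"
    and "lipschitz_around f xstar" "lipschitz_around g xstar" "lipschitz_around h xstar"
    and "horizon_quasi_normality \<Phi> g h xstar \<or>
         (horizon_rcpld \<Phi> g h xstar \<and> smooth_around g xstar \<and> smooth_around h xstar)"
  shows "kkt_point f \<Phi> g h xstar"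
  using assms(8) kkt_point_if_quasi_normality[OF assms(1-7)] kkt_point_if_rcpld[OF assms(1-7)] by blast

end
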